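(* Fix $d\ge 2$ and $n\ge 1$, and let $s$ be a positive integer (so $s=O(n^d)$) satisfying $$ s \le \frac12\left(\binom{n+d}{d}+1\right) - \binom{n+d}{d}^{-1}\binom{n+2d}{2d}. $$ For generically chosen $\{(w_i,z_i)\}_{i=1}^s\in(\mathbb{R}\times\mathbb{R}^n)^{\times s}$ the following holds. Let $X=\sum_{i=1}^s w_i^2\,m_d(z_i)m_d(z_i)^{\mathsf T}$ and $\mathcal{C}=\mathcal{M}^{\mathsf{ps}}_{n+1,2d}$, and run the extreme ray decomposition algorithm (described in the context) on $(\mathcal{C},X)$, with the problems defining $M_k$ and $t_k$ solved in exact arithmetic, obtaining output $\{t_k,M_k\}_{k=1}^s$. Then, almost surely, there is a reordering of the indices of $\{(w_i,z_i)\}_{i=1}^s$, namely the one for which $t_k=w_k^2\|m_d(z_k)\|_2^2$ and $M_k=\|m_d(z_k)\|_2^{-2}m_d(z_k)m_d(z_k)^{\mathsf T}$ for all $k$, such that for each $k\in\{1,\dots,s\}$ the weight $w_k^2$ and atom $z_k$ are recovered as follows: 1. $M_k$ has a unique nonzero eigenvalue $\lambda_k$; let $h_k$ be any corresponding unit eigenvector, with first entry $h_{k,1}$ (the entry indexed by the constant monomial). 2. $m_d(z_k)=\frac{1}{h_{k,1}}h_k$, and $z_k$ is read off from the degree-one entries of $m_d(z_k)$. 3. $w_k^2=t_k\,h_{k,1}^2$.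
   Context: Multi-indices: $\mathbb{N}^{n}_{\le d}=\{\alpha\in\mathbb{N}^n: |\alpha|\le d\}$ and $\mathbb{N}^{n}_{d}=\{\alpha\in\mathbb{N}^n:|\alpha|=d\}$, ordered by the graded lexicographic order. For $z\in\mathbb{R}^n$, $m_d(z)=(z^\alpha)_{\alpha\in\mathbb{N}^n_{\le d}}\in\mathbb{R}^{\binom{n+d}{d}}$ is the vector of all monomials of degree at most $d$ (first entry $1$). With $\tilde z=[1;z]\in\mathbb{R}^{n+1}$, $m_d(z)=v_d(\tilde z)$, where $v_d(u)=(u^\alpha)_{\alpha\in\mathbb{N}^{n+1}_d}$; i.e. index sets are identified by $\alpha\leftrightarrow(d-|\alpha|,\alpha)$. $\mathbb{S}^N$ is the space of real symmetric $N\times N$ matrices, $\mathbb{S}^N_+$ the positive semidefinite cone, $\langle A,B\rangle=\mathrm{tr}(AB)$. With $N=\binom{n+d}{d}$ and rows/columns indexed by $\mathbb{N}^{n+1}_d$, let $$\mathcal{H}_{n+1,d}=\{X\in\mathbb{S}^N : X_{\alpha,\beta}=X_{\alpha',\beta'}\ \text{for all } \alpha,\beta,\alpha',\beta'\in\mathbb{N}^{n+1}_d \text{ with } \alpha+\beta=\alpha'+\beta'\}$$ and $\mathcal{M}^{\mathsf{ps}}_{n+1,2d}=\mathcal{H}_{n+1,d}\cap\mathbb{S}^N_+$. For a convex set $C$ and $x\in C$, $\mathrm{minface}(x,C)$ is the minimal face of $C$ containing $x$. A property holds for generically chosen elements of the real vector space $(\mathbb{R}\times\mathbb{R}^n)^{\times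 s}$ if there is a Zariski-open dense subset on which it holds. "Almost surely" refers to the randomness of the matrices $B_k$ below. Extreme ray decomposition algorithm. Input: a nonempty spectrahedral cone $\mathcal{C}\subseteq\mathbb{S}^N$ (intersection of $\mathbb{S}^N_+$ with a linear subspace) and $0\neq X\in\mathcal{C}$. Set $k=1$, $X_1=X$. While $X_k\neq 0$: 1. $\mathcal{F}_k=\mathrm{minface}(X_k,\mathcal{C})$. 2. Draw a fresh random matrix $B_k$ (independently of the previous iterations) from any distribution on $\mathbb{S}^N$ that is absolutely continuous with respect to Lebesgue measure. 3. Choose $M_k\in\arg\min\{\langle B_k,Y\rangle : Y\in\mathcal{F}_k,\ \mathrm{tr}(Y)=1\}$. 4. Set $t_k=\sup\{t\ge 0: X_k-tM_k\in\mathcal{F}_k\}$. 5. Set $X_{k+1}=X_k-t_kM_k$ and increase $k$ by one. When the loop ends, return $r=k-1$ and $\{t_k,M_k\}_{k=1}^r$. *)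

theory Defs
  imports "HOL-Probability.Probability"
begin

text \<open>
  The numbers \<open>n\<close> and \<open>d\<close> are cardinalities of finite types. The type \<open>('n, 'd) multi_index\<close> is the
  set of exponent vectors of total degree \<open>d = CARD('d)\<close> in the \<open>n + 1\<close> variables \<open>'n option\<close>, where
  \<open>None\<close> is the homogenising variable. An exponent \<open>\<alpha>\<close> of degree at most \<open>d\<close> in the variables \<open>'n\<close>
  corresponds to \<open>(d - \<bar>\<alpha>\<bar>, \<alpha>)\<close>.
\<close>

typedef (overloaded) ('n::finite, 'd::finite) multi_index =
    "{\<alpha> :: 'n option \<Rightarrow> nat. (\<Sum>i\<in>UNIV. \<alpha> i) = CARD('d)}"
  morphisms expo Multi_index
proof
  show "(\<lambda>i. if i = None then CARD('d) else 0) \<in> {\<alpha> :: 'n option \<Rightarrow> nat. (\<Sum>i\<in>UNIV. \<alpha> i) = CARD('d)}"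
    by simp
qed

instance multi_index :: (finite, finite) finite
proof
  let ?S = "{\<alpha> :: 'a option \<Rightarrow> nat. (\<Sum>i\<in>UNIV. \<alpha> i) = CARD('b)}"
  have "?S \<subseteq> (UNIV :: 'a option set) \<rightarrow>\<^sub>E {.. CARD('b)}"
  proof
    fix \<alpha> :: "'a option \<Rightarrow> nat"
    assume "\<alpha> \<in> ?S"
    then have "\<alpha> i \<le> CARD('b)" for i
      using member_le_sum[of i UNIV \<alpha>] by simp
    then show "\<alpha> \<in> UNIV \<rightarrow>\<^sub>E {.. CARD('b)}"
      by (simp add: PiE_iff)
  qed
  then have "finite ?S"
    by (rule finite_subset) (intro finite_PiE; simp)
  then have "finite (Multi_index ` ?S :: ('a, 'b) multi_index set)"
    by (rule finite_imageI)
  moreover have "(UNIV :: ('a, 'b) multi_index set) \<subseteq> Multi_index ` ?S"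
  proof
    fix x :: "('a, 'b) multi_index"
    show "x \<in> Multi_index ` ?S"
      using expo[of x] expo_inverse[of x] by (intro image_eqI[of _ _ "expo x"]) simp_all
  qed
  ultimately show "finite (UNIV :: ('a, 'b) multi_index set)"
    by (rule finite_subset[rotated])
qed

definition const_index :: "('n::finite, 'd::finite) multi_index" where
  "const_index = Multi_index (\<lambda>i. if i = None then CARD('d) else 0)"

definition linear_index :: "'n::finite \<Rightarrow> ('n, 'd::finite) multi_index" where
  "linear_index j = Multi_index (\<lambda>i. case i of None \<Rightarrow> CARD('d) - 1 | Some k \<Rightarrow> if k = j then 1 else 0)"

definition veronese :: "real ^ 'n::finite option \<Rightarrow> real ^ ('n, 'd::finite) multi_index" where
  "veronese u = (\<chi> \<alpha>. \<Prod>i\<in>UNIV. (u $ i) ^ expo \<alpha> i)"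

definition homogenize :: "real ^ 'n::finite \<Rightarrow> real ^ 'n option" where
  "homogenize z = (\<chi> i. case i of None \<Rightarrow> 1 | Some j \<Rightarrow> z $ j)"

definition monomials :: "real ^ 'n::finite \<Rightarrow> real ^ ('n, 'd::finite) multi_index" where
  "monomials z = veronese (homogenize z)"

lemma sum_option_UNIV:
  "(\<Sum>i\<in>(UNIV :: 'n::finite option set). f i) = (f None + (\<Sum>j\<in>UNIV. f (Some j)) :: 'b::comm_monoid_add)"
  by (simp add: UNIV_option_conv sum.reindex)

lemma prod_option_UNIV:
  "(\<Prod>i\<in>(UNIV :: 'n::finite option set). f i) = (f None * (\<Prod>j\<in>UNIV. f (Some j)) :: 'b::comm_monoid_mult)"
  by (simp add: UNIV_option_conv prod.reindex)

lemma expo_const_index: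
  "expo (const_index :: ('n::finite, 'd::finite) multi_index) = (\<lambda>i. if i = None then CARD('d) else 0)"
  unfolding const_index_def by (subst Multi_index_inverse) auto

lemma expo_linear_index:
  "expo (linear_index j :: ('n::finite, 'd::finite) multi_index) =
     (\<lambda>i. case i of None \<Rightarrow> CARD('d) - 1 | Some k \<Rightarrow> if k = j then 1 else 0)"
  unfolding linear_index_def
  by (subst Multi_index_inverse) (simp_all add: sum_option_UNIV Suc_leI sum.delta)

lemma monomials_nth: "monomials z $ \<alpha> = (\<Prod>j\<in>UNIV. (z $ j) ^ expo \<alpha> (Some j))"
  by (simp add: monomials_def veronese_def homogenize_def prod_option_UNIV)

lemma monomials_const_index: "monomials z $ const_index = 1"
  by (simp add: monomials_nth expo_const_index)

lemma monomials_linear_index: "monomials z $ linear_index j = z $ j"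
proof -
  have "(\<Prod>i\<in>UNIV. (z $ i) ^ (if i = j then 1 else 0)) = (\<Prod>i\<in>UNIV. if i = j then z $ i else 1)"
    by (rule prod.cong) auto
  then show ?thesis
    by (simp add: monomials_nth expo_linear_index prod.delta)
qed

definition outer :: "real ^ 'm \<Rightarrow> real ^ 'm ^ 'm::finite" where
  "outer v = (columnvector v :: real ^ 1 ^ 'm) ** rowvector v"

definition psd_cone :: "(real ^ 'm ^ 'm::finite) set" where
  "psd_cone = {A. transpose A = A \<and> (\<forall>v. 0 \<le> v \<bullet> (A *v v))}"

definition hankel :: "(real ^ ('n, 'd) multi_index ^ ('n::finite, 'd::finite) multi_index) set" where
  "hankel = {A. transpose A = A \<and>
     (\<forall>\<alpha> \<beta> \<alpha>' \<beta>'. (\<forall>i. expo \<alpha> i + expo \<beta> i = expo \<alpha>' i + expo \<beta>' i) \<longrightarrow> A $ \<alpha> $ \<beta> = A $ \<alpha>' $ \<beta>')}"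

definition pseudo_moment_cone :: "(real ^ ('n, 'd) multi_index ^ ('n::finite, 'd::finite) multi_index) set" where
  "pseudo_moment_cone = hankel \<inter> psd_cone"

definition eigenvector :: "real ^ 'm ^ 'm::finite \<Rightarrow> real \<Rightarrow> real ^ 'm \<Rightarrow> bool" where
  "eigenvector A l h \<longleftrightarrow> h \<noteq> 0 \<and> A *v h = l *\<^sub>R h"

definition eigenvalue :: "real ^ 'm ^ 'm::finite \<Rightarrow> real \<Rightarrow> bool" where
  "eigenvalue A l \<longleftrightarrow> (\<exists>h. eigenvector A l h)"

definition minface :: "'a::real_vector \<Rightarrow> 'a set \<Rightarrow> 'a set" where
  "minface x C = \<Inter>{F. F face_of C \<and> x \<in> F}"

definition zariski_closed :: "'a::euclidean_space set \<Rightarrow> bool" where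
  "zariski_closed V \<longleftrightarrow> (\<exists>P. (\<forall>p\<in>P. real_polynomial_function p) \<and> V = {x. \<forall>p\<in>P. p x = 0})"

text \<open>
  Density is stated in the Euclidean topology. It implies Zariski density, and for a Zariski-open
  subset of a real vector space the two are equivalent.
\<close>

definition generically :: "('a::euclidean_space \<Rightarrow> bool) \<Rightarrow> bool" where
  "generically P \<longleftrightarrow> (\<exists>U. zariski_closed (- U) \<and> closure U = UNIV \<and> (\<forall>x\<in>U. P x))"

text \<open>
  Lebesgue measure on the symmetric matrices, in the coordinates given by the entries on and above
  the diagonal. These coordinates are the unordered pairs of indices. As a measure on all square
  matrices it is concentrated on the symmetric ones.
\<close>

definition sym_matrix :: "('m set \<Rightarrow> real) \<Rightarrow> real ^ 'm ^ 'm::finite" where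
  "sym_matrix x = (\<chi> i j. x {i, j})"

definition sym_lborel :: "(real ^ 'm ^ 'm::finite) measure" where
  "sym_lborel = distr (\<Pi>\<^sub>M p\<in>{p. \<exists>i j. p = {i, j}}. lborel) borel sym_matrix"

lemma measurable_sym_matrix:
  "(sym_matrix :: ('m::finite set \<Rightarrow> real) \<Rightarrow> _) \<in> (\<Pi>\<^sub>M p\<in>{p. \<exists>i j. p = {i, j}}. (lborel :: real measure)) \<rightarrow>\<^sub>M borel"
proof -
  have *: "(\<lambda>x. x {i, j}) \<in> borel_measurable (\<Pi>\<^sub>M p\<in>{p. \<exists>i j. p = {i, j}}. (lborel :: real measure))"
    for i j :: 'm
  proof -
    have "(\<lambda>x. x {i, j}) \<in> (\<Pi>\<^sub>M p\<in>{p. \<exists>i j. p = {i, j}}. (lborel :: real measure)) \<rightarrow>\<^sub>M lborel"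
      by (rule measurable_component_singleton) blast
    then show ?thesis
      by (simp add: measurable_lborel1)
  qed
  show ?thesis
    by (rule borel_measurable_euclidean_space[THEN iffD2])
       (auto simp: Basis_vec_def inner_axis sym_matrix_def intro!: *)
qed

lemma space_sym_lborel [simp]: "space sym_lborel = UNIV"
  and sets_sym_lborel [simp]: "sets sym_lborel = sets borel"
  by (simp_all add: sym_lborel_def)

text \<open>
  One pass through the loop body of the extreme ray decomposition algorithm, from the iterate \<open>X\<close>
  (which must be nonzero) to \<open>X'\<close>. The choice of the minimiser is nondeterministic, so this is a
  relation. In a run, \<open>Xs k\<close>, \<open>t k\<close>, \<open>M k\<close> and \<open>B k\<close> are indexed from \<open>1\<close>; a run with \<open>r\<close> iterations
  need not have reached the end of the loop.
\<close>

definition erd_step ::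
  "(real ^ 'm ^ 'm::finite) set \<Rightarrow> real ^ 'm ^ 'm \<Rightarrow> real ^ 'm ^ 'm \<Rightarrow>
     real \<Rightarrow> real ^ 'm ^ 'm \<Rightarrow> real ^ 'm ^ 'm \<Rightarrow> bool" where
  "erd_step C B X t M X' \<longleftrightarrow>
     X \<noteq> 0 \<and>
     is_arg_min (\<lambda>Y. trace (B ** Y)) (\<lambda>Y. Y \<in> minface X C \<and> trace Y = 1) M \<and>
     t = Sup {\<tau>. 0 \<le> \<tau> \<and> X - \<tau> *\<^sub>R M \<in> minface X C} \<and>
     X' = X - t *\<^sub>R M"

definition erd_run ::
  "(real ^ 'm ^ 'm::finite) set \<Rightarrow> real ^ 'm ^ 'm \<Rightarrow> (nat \<Rightarrow> real ^ 'm ^ 'm) \<Rightarrow>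
     nat \<Rightarrow> (nat \<Rightarrow> real ^ 'm ^ 'm) \<Rightarrow> (nat \<Rightarrow> real) \<Rightarrow> (nat \<Rightarrow> real ^ 'm ^ 'm) \<Rightarrow> bool" where
  "erd_run C X B r Xs t M \<longleftrightarrow>
     Xs 1 = X \<and> (\<forall>k\<in>{1..r}. erd_step C (B k) (Xs k) (t k) (M k) (Xs (k + 1)))"

definition erd_output ::
  "(real ^ 'm ^ 'm::finite) set \<Rightarrow> real ^ 'm ^ 'm \<Rightarrow> (nat \<Rightarrow> real ^ 'm ^ 'm) \<Rightarrow>
     nat \<Rightarrow> (nat \<Rightarrow> real) \<Rightarrow> (nat \<Rightarrow> real ^ 'm ^ 'm) \<Rightarrow> bool" where
  "erd_output C X B r t M \<longleftrightarrow> (\<exists>Xs. erd_run C X B r Xs t M \<and> Xs (r + 1) = 0)"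

text \<open>Every execution of the algorithm ends, and none gets stuck for lack of a minimiser.\<close>

definition erd_terminates ::
  "(real ^ 'm ^ 'm::finite) set \<Rightarrow> real ^ 'm ^ 'm \<Rightarrow> (nat \<Rightarrow> real ^ 'm ^ 'm) \<Rightarrow> bool" where
  "erd_terminates C X B \<longleftrightarrow>
     (\<forall>r Xs t M. erd_run C X B r Xs t M \<longrightarrow> Xs (r + 1) \<noteq> 0 \<longrightarrow>
        (\<exists>t' M' X'. erd_step C (B (r + 1)) (Xs (r + 1)) t' M' X')) \<and>
     \<not> (\<exists>Xs t M. \<forall>r. erd_run C X B r Xs t M)"

definition reordering ::
  "('s::finite \<Rightarrow> real) \<Rightarrow> ('s \<Rightarrow> real ^ 'm::finite) \<Rightarrow> (nat \<Rightarrow> real) \<Rightarrow> (nat \<Rightarrow> real ^ 'm ^ 'm) \<Rightarrow>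
     (nat \<Rightarrow> 's) \<Rightarrow> bool" where
  "reordering w m t M \<sigma> \<longleftrightarrow>
     bij_betw \<sigma> {1..CARD('s)} UNIV \<and>
     (\<forall>k\<in>{1..CARD('s)}.
        t k = (w (\<sigma> k))\<^sup>2 * (norm (m (\<sigma> k)))\<^sup>2 \<and>
        M k = (1 / (norm (m (\<sigma> k)))\<^sup>2) *\<^sub>R outer (m (\<sigma> k)))"

end

theory Submission
  imports Defs
begin

text \<open>
  For points \<open>v i = monomials (z i)\<close> and a pair \<open>i \<noteq> j\<close>, consider the quadrics \<open>Q\<close> that are orthogonal to
  the Hankel matrices (hence vanish on the Veronese variety) and have all \<open>v k\<close> with \<open>k \<noteq> i, j\<close> in their
  kernel. With \<open>N = binom (n + d) d\<close> these are \<open>binom (n + 2 d) (2 d) + (s - 2) N\<close> linear conditions on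
  \<open>N (N + 1) / 2\<close> unknowns, so by the bound on \<open>s\<close> there is a solution \<open>Q \<noteq> 0\<close>, polynomial in the points
  other than \<open>z i\<close> and \<open>z j\<close>; generically \<open>v i \<bullet> (Q *v v j) \<noteq> 0\<close>. Pairing with \<open>Q\<close> shows that a
  Hankel matrix \<open>\<Sum> S k l v k (v l)\<^sup>T\<close> has \<open>S i j = 0\<close>, and that the \<open>v i\<close> are linearly independent.

  Therefore the minimal face of \<open>\<Sum> c i v i (v i)\<^sup>T\<close> is the simplicial cone spanned by the \<open>v i (v i)\<^sup>T\<close> with
  \<open>c i > 0\<close>. A linear functional that separates the normalised extreme rays, as almost every one does,
  has a unique minimiser on the trace one section, which is one of these rays. The step of the algorithm
  then removes exactly this ray.
\<close>

section \<open>Polynomial functions\<close>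

lemma real_polynomial_function_line:
  assumes "real_polynomial_function p"
  shows "real_polynomial_function (\<lambda>t::real. p (a + t *\<^sub>R b))"
proof -
  have "polynomial_function (\<lambda>t. a + t *\<^sub>R b)"
    by (intro polynomial_function_add polynomial_function_const polynomial_function_bounded_linear
        bounded_linear_scaleR_left)
  from real_polynomial_function_compose[OF this assms] show ?thesis
    by (simp add: o_def)
qed

lemma finite_real_polynomial_function_zeros:
  fixes p :: "real \<Rightarrow> real"
  assumes "real_polynomial_function p" "p t \<noteq> 0"
  shows "finite {t. p t = 0}"
proof -
  obtain a n where p: "p = (\<lambda>x. \<Sum>i\<le>n. a i * x ^ i)"
    using assms(1) by (auto simp: real_polynomial_function_iff_sum)
  with assms(2) have "\<exists>i\<le>n. a i \<noteq> 0"
    by (auto intro!: sum.neutral)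
  then show ?thesis
    unfolding p by (simp add: polyfun_finite_roots)
qed

text \<open>On the line through \<open>a\<close> and \<open>b\<close> both restrictions are nonzero
  univariate polynomials, so all but finitely many parameters avoid both zero sets.\<close>

lemma real_polynomial_function_mult_nonzero:
  assumes "real_polynomial_function p" "p a \<noteq> 0" "real_polynomial_function q" "q b \<noteq> 0"
  shows "\<exists>x. p x * q x \<noteq> 0"
proof -
  define l where "l = (\<lambda>t::real. a + t *\<^sub>R (b - a))"
  have "finite {t. p (l t) = 0}" "finite {t. q (l t) = 0}"
    using finite_real_polynomial_function_zeros[OF real_polynomial_function_line[OF assms(1)], of a 0 "b - a"]
      finite_real_polynomial_function_zeros[OF real_polynomial_function_line[OF assms(3)], of a 1 "b - a"] assms
    by (simp_all add: l_def)
  then have "finite ({t. p (l t) = 0} \<union> {t. q (l t) = 0})"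
    by simp
  then obtain t where "t \<notin> {t. p (l t) = 0} \<union> {t. q (l t) = 0}"
    using ex_new_if_finite infinite_UNIV_char_0 by blast
  then show ?thesis
    by auto
qed

lemma real_polynomial_function_prod_nonzero:
  assumes "finite I" "\<And>i. i \<in> I \<Longrightarrow> real_polynomial_function (f i)" "\<And>i. i \<in> I \<Longrightarrow> \<exists>x. f i x \<noteq> 0"
  shows "\<exists>x. (\<Prod>i\<in>I. f i x) \<noteq> 0"
  using assms
proof (induction I rule: finite_induct)
  case (insert i I)
  obtain a where "f i a \<noteq> 0"
    using insert.prems(2)[of i] by auto
  moreover obtain b where "(\<Prod>i\<in>I. f i b) \<noteq> 0"
    using insert by auto
  moreover have "real_polynomial_function (f i)" "real_polynomial_function (\<lambda>x. \<Prod>i\<in>I. f i x)"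
    using insert by (auto intro: real_polynomial_function_prod)
  ultimately have "\<exists>x. f i x * (\<Prod>i\<in>I. f i x) \<noteq> 0"
    by (intro real_polynomial_function_mult_nonzero)
  then show ?case
    using insert.hyps by simp
qed auto

text \<open>On the way from \<open>x\<close> to \<open>a\<close> the polynomial has only finitely
  many zeros, so nonzeros occur arbitrarily close to \<open>x\<close>.\<close>

lemma dense_real_polynomial_function_nonzero:
  fixes p :: "'a::real_normed_vector \<Rightarrow> real"
  assumes "real_polynomial_function p" "p a \<noteq> 0"
  shows "closure {x. p x \<noteq> 0} = UNIV"
proof -
  have "x \<in> closure {x. p x \<noteq> 0}" for x
  proof (cases "x = a")
    case True
    then have "x \<in> {x. p x \<noteq> 0}"
      using assms by simp
    then show ?thesis
      by (rule closure_subset[THEN subsetD])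
  next
    case False
    show ?thesis
      unfolding closure_approachable
    proof (intro allI impI)
      fix \<epsilon> :: real
      assume "\<epsilon> > 0"
      define r where "r = \<epsilon> / norm (a - x)"
      have r: "r > 0"
        using False \<open>\<epsilon> > 0\<close> by (simp add: r_def)
      have "finite {t. p (x + t *\<^sub>R (a - x)) = 0}"
        using finite_real_polynomial_function_zeros[OF real_polynomial_function_line[OF assms(1)], of x 1 "a - x"] assms
        by simp
      then have "infinite ({0<..<r} - {t. p (x + t *\<^sub>R (a - x)) = 0})"
        using r infinite_Ioo by (metis Diff_infinite_finite)
      then obtain t where "t \<in> {0<..<r} - {t. p (x + t *\<^sub>R (a - x)) = 0}"
        using infinite_imp_nonempty by blast
      then have t: "0 < t" "t < r" "p (x + t *\<^sub>R (a - x)) \<noteq> 0"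
        by auto
      have "dist (x + t *\<^sub>R (a - x)) x = t * norm (a - x)"
        using t by (simp add: dist_norm)
      also have "\<dots> < \<epsilon>"
        using False t by (simp add: r_def field_simps)
      finally have "dist (x + t *\<^sub>R (a - x)) x < \<epsilon>" .
      with t show "\<exists>y\<in>{x. p x \<noteq> 0}. dist y x < \<epsilon>"
        by blast
    qed
  qed
  then show ?thesis
    by auto
qed

text \<open>Fraction-free Gaussian elimination over a ring \<open>R\<close> of functions, one row
  per induction step. Without division the solution stays in \<open>R\<close> and satisfies the
  equations at every \<open>x\<close>, not only where the pivots are nonzero. The hypothesis
  \<open>domain\<close> expresses that \<open>R\<close> has no zero divisors.\<close>

lemma homogeneous_system_nontrivial_solution:
  fixes R :: "('x \<Rightarrow> real) set" and A :: "'k \<Rightarrow> 'j \<Rightarrow> 'x \<Rightarrow> real"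
  assumes const: "\<And>c. (\<lambda>_. c) \<in> R"
    and add: "\<And>f g. f \<in> R \<Longrightarrow> g \<in> R \<Longrightarrow> (\<lambda>x. f x + g x) \<in> R"
    and mult: "\<And>f g. f \<in> R \<Longrightarrow> g \<in> R \<Longrightarrow> (\<lambda>x. f x * g x) \<in> R"
    and domain: "\<And>f g x y. f \<in> R \<Longrightarrow> g \<in> R \<Longrightarrow> f x \<noteq> 0 \<Longrightarrow> g y \<noteq> 0 \<Longrightarrow> \<exists>z. f z * g z \<noteq> 0"
    and "finite K" "finite J" "card K < card J"
    and "\<And>k j. A k j \<in> R"
  shows "\<exists>q. (\<forall>j. q j \<in> R) \<and> (\<exists>j\<in>J. \<exists>x. q j x \<noteq> 0) \<and> (\<forall>k\<in>K. \<forall>x. (\<Sum>j\<in>J. A k j x * q j x) = 0)"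
proof -
  have minus: "(\<lambda>x. - f x) \<in> R" if "f \<in> R" for f
    using mult[OF const[of "-1"] that] by simp
  have sum_in: "(\<lambda>x. \<Sum>i\<in>I. f i x) \<in> R" if "\<And>i. f i \<in> R" for f :: "'j \<Rightarrow> 'x \<Rightarrow> real" and I
    by (induction I rule: infinite_finite_induct) (auto intro: const add that)
  show ?thesis
    using assms(5-)
  proof (induction K arbitrary: J A rule: finite_induct)
    case empty
    then have "J \<noteq> {}"
      by auto
    then show ?case
      by (intro exI[of _ "\<lambda>_ _. 1"]) (auto intro: const)
  next
    case (insert k K)
    show ?case
    proof (cases "\<forall>j\<in>J. \<forall>x. A k j x = 0")
      \<comment> \<open>A row that vanishes identically imposes nothing, so it is dropped without
        eliminating an unknown.\<close>
      case True
      have "card K < card J"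
        using insert.prems insert.hyps by simp
      from insert.IH[OF insert.prems(1) this insert.prems(3)] True show ?thesis
        by auto
    next
      case False
      then obtain i x0 where i: "i \<in> J" "A k i x0 \<noteq> 0"
        by auto
      define J' where "J' = J - {i}"
      \<comment> \<open>Cross-multiplication with the pivot \<open>A k i\<close> removes the unknown
        \<open>i\<close> from row \<open>l\<close>.\<close>
      define A' where "A' = (\<lambda>l j x. A k i x * A l j x + - (A l i x * A k j x))"
      have "finite J'" "card K < card J'"
        using insert.prems insert.hyps i by (auto simp: J'_def)
      moreover have "A' l j \<in> R" for l j
        unfolding A'_def by (intro add mult minus insert.prems(3))
      ultimately obtain q where q: "\<And>j. q j \<in> R" "\<exists>j\<in>J'. \<exists>x. q j x \<noteq> 0"
        "\<And>l x. l \<in> K \<Longrightarrow> (\<Sum>j\<in>J'. A' l j x * q j x) = 0"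
        using insert.IH[of J' A'] by blast
      \<comment> \<open>Back substitution: the other unknowns are scaled by the pivot, so that the
        value of unknown \<open>i\<close> forced by row \<open>k\<close> needs no
        denominator.\<close>
      define Q where "Q = (\<lambda>j x. if j = i then - (\<Sum>j\<in>J'. A k j x * q j x) else A k i x * q j x)"
      have "Q j \<in> R" for j
        by (cases "j = i") (auto simp: Q_def intro!: minus mult sum_in q insert.prems)
      moreover obtain j y where "j \<in> J'" "q j y \<noteq> 0"
        using q(2) by blast
      \<comment> \<open>Since there are no zero divisors, scaling by the pivot cannot turn the
        nonzero \<open>q j\<close> into zero.\<close>
      with i domain[OF insert.prems(3) q(1)] obtain z where "A k i z * q j z \<noteq> 0"
        by blast
      with \<open>j \<in> J'\<close> have "\<exists>j\<in>J. \<exists>x. Q j x \<noteq> 0"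
        by (auto simp: J'_def Q_def)
      moreover have "(\<Sum>j\<in>J. A l j x * Q j x) = 0" if "l \<in> insert k K" for l x
      proof -
        have "(\<Sum>j\<in>J. A l j x * Q j x) = A l i x * Q i x + (\<Sum>j\<in>J'. A l j x * Q j x)"
          using i insert.prems(1) by (simp add: J'_def sum.remove)
        also have "(\<Sum>j\<in>J'. A l j x * Q j x) = (\<Sum>j\<in>J'. A k i x * A l j x * q j x)"
          by (rule sum.cong) (auto simp: J'_def Q_def)
        also have "A l i x * Q i x = - (\<Sum>j\<in>J'. A l i x * A k j x * q j x)"
          by (simp add: Q_def sum_distrib_left mult_ac)
        also have "- (\<Sum>j\<in>J'. A l i x * A k j x * q j x) + (\<Sum>j\<in>J'. A k i x * A l j x * q j x)
            = (\<Sum>j\<in>J'. A' l j x * q j x)"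
          by (simp add: A'_def algebra_simps sum.distrib sum_negf sum_subtractf)
        also have "\<dots> = 0"
        \<comment> \<open>For \<open>l = k\<close> the cross-multiplied coefficients cancel
          identically; the other rows form the reduced system.\<close>
        proof (cases "l = k")
          case True
          then show ?thesis
            by (simp add: A'_def)
        qed (use that q(3) in auto)
        finally show ?thesis .
      qed
      ultimately show ?thesis
        by blast
    qed
  qed
qed

text \<open>Induction on the set of variables: for fixed values of the others the sum is a
  polynomial in variable \<open>i\<close> that vanishes everywhere, so each of its coefficients
  vanishes, and these are the sums over exponents with a fixed value at \<open>i\<close>. Exponents
  are functions on the whole type, hence the hypothesis that \<open>S\<close> already tells those in
  \<open>E\<close> apart.\<close>

lemma monomial_sum_eq_0_imp:
  fixes c :: "('i \<Rightarrow> nat) \<Rightarrow> real"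
  assumes "finite S" "finite E" "\<And>\<alpha> \<beta>. \<alpha> \<in> E \<Longrightarrow> \<beta> \<in> E \<Longrightarrow> (\<forall>i\<in>S. \<alpha> i = \<beta> i) \<Longrightarrow> \<alpha> = \<beta>"
    and "\<And>z. (\<Sum>\<alpha>\<in>E. c \<alpha> * (\<Prod>i\<in>S. z i ^ \<alpha> i)) = 0" "\<alpha> \<in> E"
  shows "c \<alpha> = 0"
  using assms
proof (induction S arbitrary: E rule: finite_induct)
  case empty
  then have "E = {\<alpha>}"
    by auto
  with empty show ?case
    by simp
next
  case (insert i S)
  define N where "N = Max ((\<lambda>\<beta>. \<beta> i) ` E)"
  have N: "\<beta> i \<le> N" if "\<beta> \<in> E" for \<beta>
    using insert.prems(1) that by (simp add: N_def)
  have "(\<Sum>\<beta>\<in>{\<beta>\<in>E. \<beta> i = \<alpha> i}. c \<beta> * (\<Prod>j\<in>S. z j ^ \<beta> j)) = 0" for z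
  proof -
    have "(\<Sum>k\<le>N. (\<Sum>\<beta>\<in>{\<beta>\<in>E. \<beta> i = k}. c \<beta> * (\<Prod>j\<in>S. z j ^ \<beta> j)) * x ^ k) = 0" for x
    proof -
      have prod: "(\<Prod>j\<in>insert i S. (z(i := x)) j ^ \<beta> j) = x ^ \<beta> i * (\<Prod>j\<in>S. z j ^ \<beta> j)" for \<beta>
      proof -
        have "(\<Prod>j\<in>S. (z(i := x)) j ^ \<beta> j) = (\<Prod>j\<in>S. z j ^ \<beta> j)"
          using insert.hyps(2) by (intro prod.cong) auto
        then show ?thesis
          using insert.hyps by simp
      qed
      have "(\<Sum>k\<le>N. (\<Sum>\<beta>\<in>{\<beta>\<in>E. \<beta> i = k}. c \<beta> * (\<Prod>j\<in>S. z j ^ \<beta> j)) * x ^ k)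
          = (\<Sum>k\<le>N. \<Sum>\<beta>\<in>{\<beta>\<in>E. \<beta> i = k}. c \<beta> * (\<Prod>j\<in>insert i S. (z(i := x)) j ^ \<beta> j))"
        unfolding prod sum_distrib_right by (intro sum.cong refl) (auto simp: mult_ac)
      also have "\<dots> = (\<Sum>\<beta>\<in>E. c \<beta> * (\<Prod>j\<in>insert i S. (z(i := x)) j ^ \<beta> j))"
        using insert.prems(1) N by (intro sum.group) auto
      also have "\<dots> = 0"
        by (rule insert.prems)
      finally show ?thesis .
    qed
    then show ?thesis
      using N[OF insert.prems(4)] polyfun_eq_0[of "\<lambda>k. \<Sum>\<beta>\<in>{\<beta>\<in>E. \<beta> i = k}. c \<beta> * (\<Prod>j\<in>S. z j ^ \<beta> j)" N]
      by blast
  qed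
  \<comment> \<open>Within the slice all exponents agree at \<open>i\<close>, so those that agree on
    \<open>S\<close> are still equal.\<close>
  then show ?case
    using insert.prems by (intro insert.IH[of "{\<beta>\<in>E. \<beta> i = \<alpha> i}"]) auto
qed

text \<open>If \<open>a\<close> were orthogonal to every monomial vector, its entries would be the
  coefficients of a vanishing polynomial in the affine variables. Dropping the exponent of
  \<open>None\<close> loses nothing, since the total degree determines it.\<close>

lemma monomials_spanning:
  fixes a :: "real ^ ('n::finite, 'd::finite) multi_index"
  assumes "a \<noteq> 0"
  shows "\<exists>z. a \<bullet> monomials z \<noteq> 0"
proof (rule ccontr)
  assume "\<not> ?thesis"
  then have zero: "a \<bullet> monomials z = 0" for z
    by auto
  define f where "f = (\<lambda>(\<alpha> :: ('n, 'd) multi_index) i. expo \<alpha> (Some i))"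
  have inj: "inj f"
  proof (rule injI)
    fix \<alpha> \<beta> :: "('n, 'd) multi_index"
    assume "f \<alpha> = f \<beta>"
    then have Some: "expo \<alpha> (Some i) = expo \<beta> (Some i)" for i
      by (auto simp: f_def fun_eq_iff)
    have "expo \<alpha> None + (\<Sum>i\<in>UNIV. expo \<alpha> (Some i)) = expo \<beta> None + (\<Sum>i\<in>UNIV. expo \<beta> (Some i))"
      using expo[of \<alpha>] expo[of \<beta>] by (simp add: sum_option_UNIV)
    then have "expo \<alpha> None = expo \<beta> None"
      by (simp add: Some)
    with Some have "expo \<alpha> i = expo \<beta> i" for i
      by (cases i) auto
    then show "\<alpha> = \<beta>"
      by (simp add: expo_inject[symmetric] fun_eq_iff)
  qed
  have "a $ \<alpha> = 0" for \<alpha>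
  proof -
    have "a $ inv f (f \<alpha>) = 0"
    proof (rule monomial_sum_eq_0_imp[of UNIV "range f" "\<lambda>\<beta>. a $ inv f \<beta>"])
      fix z :: "'n \<Rightarrow> real"
      have "(\<Sum>\<beta>\<in>range f. a $ inv f \<beta> * (\<Prod>i\<in>UNIV. z i ^ \<beta> i)) = a \<bullet> monomials (\<chi> i. z i)"
        by (simp add: sum.reindex[OF inj] inv_f_f[OF inj] inner_vec_def monomials_nth) (simp add: f_def)
      then show "(\<Sum>\<beta>\<in>range f. a $ inv f \<beta> * (\<Prod>i\<in>UNIV. z i ^ \<beta> i)) = 0"
        by (simp add: zero)
    qed auto
    then show ?thesis
      using inj by simp
  qed
  then have "a = 0"
    by (simp add: vec_eq_iff)
  with assms show False ..
qed

section \<open>Sections of the positive semidefinite cone with a simplicial face\<close>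

lemma outer_nth: "outer v $ i $ j = v $ i * v $ j"
  by (simp add: outer_def matrix_matrix_mult_def columnvector_def rowvector_def)

lemma outer_mult_vec: "outer v *v y = (v \<bullet> y) *\<^sub>R v"
  by (simp add: vec_eq_iff matrix_vector_mult_def outer_nth inner_vec_def sum_distrib_left mult_ac)

lemma transpose_outer: "transpose (outer v) = outer v"
  by (simp add: vec_eq_iff transpose_def outer_nth)

lemma trace_outer: "trace (outer v) = (norm v)\<^sup>2"
  by (simp add: trace_def outer_nth power2_norm_eq_inner inner_vec_def)

lemma trace_scaleR: "trace (c *\<^sub>R A) = c * trace (A :: real ^ 'n ^ 'n)"
  by (simp add: trace_def sum_distrib_left)

lemma trace_sum: "trace (\<Sum>i\<in>I. A i) = (\<Sum>i\<in>I. trace (A i :: real ^ 'n ^ 'n))"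
  by (induction I rule: infinite_finite_induct) (simp_all add: trace_def sum.distrib)

lemma matrix_mult_scaleR_right: "B ** (c *\<^sub>R A) = c *\<^sub>R (B ** (A :: real ^ 'n ^ 'n))"
  by (simp add: vec_eq_iff matrix_matrix_mult_def sum_distrib_left mult_ac)

lemma matrix_mult_sum_right: "B ** (\<Sum>i\<in>I. A i) = (\<Sum>i\<in>I. B ** (A i :: real ^ 'n ^ 'n))"
  by (induction I rule: infinite_finite_induct) (simp_all add: matrix_add_ldistrib)

lemma sum_matrix_mult_vec: "(\<Sum>i\<in>I. A i) *v y = (\<Sum>i\<in>I. A i *v (y :: real ^ 'n))"
  by (induction I rule: infinite_finite_induct) (simp_all add: matrix_vector_mult_add_rdistrib)

lemma scaleR_matrix_mult_vec: "(c *\<^sub>R A) *v y = c *\<^sub>R (A *v (y :: real ^ 'n))"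
  by (simp add: vec_eq_iff matrix_vector_mult_def sum_distrib_left mult_ac)

lemma symmetric_matrix_inner:
  fixes A :: "real ^ 'n ^ 'n"
  assumes "transpose A = A"
  shows "x \<bullet> (A *v y) = y \<bullet> (A *v x)"
  by (metis assms dot_lmul_matrix inner_commute transpose_matrix_vector)

text \<open>Along \<open>y + t *\<^sub>R z\<close> with \<open>z = A *v y\<close> the form is
  \<open>2 t |z|^2 + O(t^2)\<close>, which a small negative \<open>t\<close> makes negative unless
  \<open>z = 0\<close>.\<close>

lemma psd_cone_mult_eq_0:
  assumes "A \<in> psd_cone" "y \<bullet> (A *v y) = 0"
  shows "A *v y = 0"
proof -
  have sym: "transpose A = A" and pos: "\<And>v. 0 \<le> v \<bullet> (A *v v)"
    using assms(1) by (auto simp: psd_cone_def)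
  define z where "z = A *v y"
  have quadr: "0 \<le> 2 * t * (z \<bullet> z) + t\<^sup>2 * (z \<bullet> (A *v z))" for t
  proof -
    have "(y + t *\<^sub>R z) \<bullet> (A *v (y + t *\<^sub>R z))
        = y \<bullet> (A *v y) + t * (y \<bullet> (A *v z)) + t * (z \<bullet> (A *v y)) + t\<^sup>2 * (z \<bullet> (A *v z))"
      by (simp add: matrix_vector_right_distrib matrix_vector_mult_scaleR inner_add_left inner_add_right
          algebra_simps power2_eq_square)
    also have "\<dots> = 2 * t * (z \<bullet> z) + t\<^sup>2 * (z \<bullet> (A *v z))"
      using assms(2) symmetric_matrix_inner[OF sym, of y z] by (simp add: z_def)
    finally show ?thesis
      using pos by metis
  qed
  have "z \<bullet> z = 0"
  proof (rule ccontr)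
    assume "z \<bullet> z \<noteq> 0"
    then have "z \<bullet> z > 0"
      by simp
    define c where "c = z \<bullet> (A *v z)"
    have "c \<ge> 0"
      using pos by (simp add: c_def)
    \<comment> \<open>The denominator \<open>c + 1\<close> is positive even for
      \<open>c = 0\<close>, and this choice gives \<open>t * c > - (z \<bullet> z)\<close>.\<close>
    define t where "t = - (z \<bullet> z) / (c + 1)"
    have "t < 0" "t * (c + 1) = - (z \<bullet> z)"
      using \<open>z \<bullet> z > 0\<close> \<open>c \<ge> 0\<close> by (auto simp: t_def divide_neg_pos)
    then have "t * c > - (z \<bullet> z)"
      by (simp add: algebra_simps)
    then have "2 * (z \<bullet> z) + t * c > 0"
      using \<open>z \<bullet> z > 0\<close> by linarith
    then have "t * (2 * (z \<bullet> z) + t * c) < 0"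
      using \<open>t < 0\<close> by (simp add: mult_neg_pos)
    with quadr[of t] show False
      by (simp add: c_def algebra_simps power2_eq_square)
  qed
  then show ?thesis
    by (simp add: z_def)
qed

text \<open>The scaled matrix is the orthogonal projection onto the line through \<open>v\<close>,
  and its range contains every eigenvector of a nonzero eigenvalue.\<close>

lemma eigenvector_rank_one:
  assumes "v \<noteq> 0" "l \<noteq> 0" "eigenvector ((1 / (norm v)\<^sup>2) *\<^sub>R outer v) l h"
  shows "l = 1" "\<exists>c. c \<noteq> 0 \<and> h = c *\<^sub>R v"
proof -
  define c where "c = (v \<bullet> h) / (norm v)\<^sup>2"
  have h: "h \<noteq> 0" "c *\<^sub>R v = l *\<^sub>R h"
    using assms(3) by (auto simp: eigenvector_def scaleR_matrix_mult_vec outer_mult_vec c_def)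
  have hv: "h = (c / l) *\<^sub>R v"
    using arg_cong[OF h(2), of "\<lambda>x. (1 / l) *\<^sub>R x"] assms(2) by simp
  then show "\<exists>c. c \<noteq> 0 \<and> h = c *\<^sub>R v"
    using h(1) by (intro exI[of _ "c / l"]) auto
  have "c \<noteq> 0"
    using hv h(1) by auto
  have "c = c / l"
    unfolding c_def by (subst hv) (use assms in \<open>simp add: power2_norm_eq_inner c_def\<close>)
  with \<open>c \<noteq> 0\<close> assms(2) show "l = 1"
    by (simp add: field_simps)
qed

lemma eigenvalue_rank_one:
  assumes "v \<noteq> 0"
  shows "eigenvalue ((1 / (norm v)\<^sup>2) *\<^sub>R outer v) 1"
  unfolding eigenvalue_def eigenvector_def
  by (rule exI[of _ v])
    (use assms in \<open>simp add: scaleR_matrix_mult_vec outer_mult_vec power2_norm_eq_inner\<close>)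

text \<open>What the analysis of the algorithm uses of the moment setting. The vectors
  \<open>e\<close> witness the linear independence of the \<open>v i\<close>. By
  \<open>off_diagonal\<close>, a symmetric combination of the \<open>v k (v l)^T\<close> that lies
  in \<open>L\<close> has no mixed terms, which makes the faces simplicial cones; the combination is
  expressed through its action on vectors.\<close>

locale simplicial_section =
  fixes L :: "(real ^ 'm::finite ^ 'm) set" and v e :: "'s::finite \<Rightarrow> real ^ 'm"
  assumes subspace_L: "subspace L"
    and outer_in_L: "outer (v i) \<in> L"
    and dual: "e i \<bullet> v j = (if i = j then 1 else 0)"
    and off_diagonal: "\<lbrakk>Y \<in> L; \<And>y. Y *v y = (\<Sum>l\<in>UNIV. \<Sum>k\<in>UNIV. (S k l * (v l \<bullet> y)) *\<^sub>R v k);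
      \<And>k l. S k l = S l k; i \<noteq> j\<rbrakk> \<Longrightarrow> S i j = (0 :: real)"
begin

definition comb :: "('s \<Rightarrow> real) \<Rightarrow> real ^ 'm ^ 'm" where
  "comb c = (\<Sum>i\<in>UNIV. c i *\<^sub>R outer (v i))"

text \<open>The extreme ray through \<open>outer (v i)\<close>, scaled to trace one: a vertex of the
  simplex that the trace one section cuts out of a face.\<close>

definition vertex :: "'s \<Rightarrow> real ^ 'm ^ 'm" where
  "vertex i = (1 / (norm (v i))\<^sup>2) *\<^sub>R outer (v i)"

section \<open>Coefficients of combinations of the extreme rays\<close>

lemma v_nonzero: "v i \<noteq> 0"
  using dual[of i i] by auto

lemma norm_v_pos: "(norm (v i))\<^sup>2 > 0"
  using v_nonzero by simp

lemma comb_mult_vec: "comb c *v y = (\<Sum>i\<in>UNIV. (c i * (v i \<bullet> y)) *\<^sub>R v i)"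
  by (simp add: comb_def sum_matrix_mult_vec scaleR_matrix_mult_vec outer_mult_vec)

text \<open>Evaluating the form at a dual vector isolates one coefficient; this is why coefficients
  are unique.\<close>

lemma comb_coeff: "e j \<bullet> (comb c *v e j) = c j"
proof -
  have "e j \<bullet> (comb c *v e j) = (\<Sum>i\<in>UNIV. if j = i then c i else 0)"
    unfolding comb_mult_vec inner_sum_right
    by (intro sum.cong refl) (simp add: dual inner_commute[of "v _" "e _"])
  then show ?thesis
    by simp
qed

lemma comb_inject: "comb a = comb b \<longleftrightarrow> a = b"
  by (metis comb_coeff ext)

lemma comb_add: "comb a + comb b = comb (\<lambda>i. a i + b i)"
  by (simp add: comb_def scaleR_add_left sum.distrib)

lemma comb_scaleR: "u *\<^sub>R comb a = comb (\<lambda>i. u * a i)"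
  by (simp add: comb_def scaleR_sum_right)

lemma comb_diff: "comb a - comb b = comb (\<lambda>i. a i - b i)"
  by (simp add: comb_def scaleR_diff_left sum_subtractf)

lemma comb_0: "comb (\<lambda>_. 0) = 0"
  by (simp add: comb_def)

lemma comb_eq_0_iff: "comb a = 0 \<longleftrightarrow> (\<forall>i. a i = 0)"
  using comb_inject[of a "\<lambda>_. 0"] by (auto simp: comb_0)

lemma vertex_eq_comb: "vertex i = comb (\<lambda>j. if j = i then 1 / (norm (v i))\<^sup>2 else 0)"
proof -
  have "comb (\<lambda>j. if j = i then 1 / (norm (v i))\<^sup>2 else 0)
      = (\<Sum>j\<in>UNIV. if j = i then (1 / (norm (v i))\<^sup>2) *\<^sub>R outer (v i) else 0)"
    unfolding comb_def by (intro sum.cong) auto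
  then show ?thesis
    by (simp add: vertex_def)
qed

lemma vertex_inject: "vertex i = vertex j \<longleftrightarrow> i = j"
  unfolding vertex_eq_comb comb_inject using norm_v_pos
  by (metis divide_eq_0_iff order_less_irrefl zero_neq_one)

lemma comb_in_cone:
  assumes "\<And>i. 0 \<le> c i"
  shows "comb c \<in> L \<inter> psd_cone"
proof
  show "comb c \<in> L"
    unfolding comb_def by (intro subspace_sum subspace_scale subspace_L outer_in_L)
  have "transpose (comb c) = comb c"
    by (simp add: vec_eq_iff transpose_def comb_def outer_nth mult_ac)
  moreover have "0 \<le> y \<bullet> (comb c *v y)" for y
    unfolding comb_mult_vec inner_sum_right
    by (rule sum_nonneg) (simp add: assms inner_commute[of "v _" y] mult_ac)
  ultimately show "comb c \<in> psd_cone"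
    by (simp add: psd_cone_def)
qed

text \<open>Expanding in the dual vectors writes \<open>Y\<close> as a combination of the \<open>v k (v l)\<^sup>T\<close> with \<open>k\<close>
  and \<open>l\<close> in the support of \<open>c\<close>; then \<open>off_diagonal\<close> leaves only the terms \<open>k = l\<close>.\<close>

lemma in_cone_kernel_imp_comb:
  assumes "Y \<in> L \<inter> psd_cone" "\<And>y. (\<And>i. c i \<noteq> 0 \<Longrightarrow> v i \<bullet> y = 0) \<Longrightarrow> Y *v y = 0"
  shows "\<exists>a. (\<forall>i. 0 \<le> a i) \<and> (\<forall>i. c i = 0 \<longrightarrow> a i = 0) \<and> Y = comb a"
proof -
  have sym: "transpose Y = Y" and pos: "\<And>y. 0 \<le> y \<bullet> (Y *v y)"
    using assms(1) by (auto simp: psd_cone_def)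
  define I where "I = {i. c i \<noteq> 0}"
  \<comment> \<open>The remainder
    \<open>y - (\<Sum>l\<in>I. (v l \<bullet> y) *\<^sub>R e l)\<close> is orthogonal to every
    \<open>v i\<close> in the support, so \<open>Y\<close> annihilates it by assumption.\<close>
  have expand: "Y *v y = (\<Sum>l\<in>I. (v l \<bullet> y) *\<^sub>R (Y *v e l))" for y
  proof -
    have "v i \<bullet> (y - (\<Sum>l\<in>I. (v l \<bullet> y) *\<^sub>R e l)) = 0" if "c i \<noteq> 0" for i
    proof -
      have "v i \<bullet> (\<Sum>l\<in>I. (v l \<bullet> y) *\<^sub>R e l) = (\<Sum>l\<in>I. if l = i then v l \<bullet> y else 0)"
        unfolding inner_sum_right
        by (intro sum.cong refl) (simp add: dual inner_commute[of "v _" "e _"])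
      then show ?thesis
        using that by (simp add: I_def inner_diff_right)
    qed
    then have "Y *v (y - (\<Sum>l\<in>I. (v l \<bullet> y) *\<^sub>R e l)) = 0"
      by (rule assms(2))
    then show ?thesis
      by (simp add: matrix_vector_mult_diff_distrib linear_sum[OF matrix_vector_mul_linear]
          matrix_vector_mult_scaleR)
  qed
  \<comment> \<open>The value zero off the support lets the sums run over \<open>UNIV\<close>, the
    form in which \<open>off_diagonal\<close> takes them.\<close>
  define S where "S = (\<lambda>k l. if k \<in> I \<and> l \<in> I then e k \<bullet> (Y *v e l) else 0)"
  have Ye: "Y *v e l = (\<Sum>k\<in>UNIV. S k l *\<^sub>R v k)" if "l \<in> I" for l
  proof (rule vector_eq_ldot[THEN iffD1], rule allI)
    fix z
    have "z \<bullet> (Y *v e l) = e l \<bullet> (Y *v z)"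
      by (rule symmetric_matrix_inner[OF sym])
    also have "\<dots> = (\<Sum>k\<in>I. (v k \<bullet> z) * (e l \<bullet> (Y *v e k)))"
      by (subst expand) (simp add: inner_sum_right)
    also have "\<dots> = (\<Sum>k\<in>I. (v k \<bullet> z) * (e k \<bullet> (Y *v e l)))"
      by (simp add: symmetric_matrix_inner[OF sym, of "e l"])
    also have "\<dots> = (\<Sum>k\<in>UNIV. z \<bullet> (S k l *\<^sub>R v k))"
      using that by (intro sum.mono_neutral_cong_left) (auto simp: S_def inner_commute)
    also have "\<dots> = z \<bullet> (\<Sum>k\<in>UNIV. S k l *\<^sub>R v k)"
      by (simp add: inner_sum_right)
    finally show "z \<bullet> (Y *v e l) = z \<bullet> (\<Sum>k\<in>UNIV. S k l *\<^sub>R v k)" .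
  qed
  have YS: "Y *v y = (\<Sum>l\<in>UNIV. \<Sum>k\<in>UNIV. (S k l * (v l \<bullet> y)) *\<^sub>R v k)" for y
  proof -
    have "Y *v y = (\<Sum>l\<in>I. \<Sum>k\<in>UNIV. (S k l * (v l \<bullet> y)) *\<^sub>R v k)"
      by (subst expand) (auto intro!: sum.cong simp: Ye scaleR_sum_right mult_ac)
    also have "\<dots> = (\<Sum>l\<in>UNIV. \<Sum>k\<in>UNIV. (S k l * (v l \<bullet> y)) *\<^sub>R v k)"
      by (rule sum.mono_neutral_left) (auto simp: S_def)
    finally show ?thesis .
  qed
  have "S k l = S l k" for k l
    by (simp add: S_def symmetric_matrix_inner[OF sym, of "e k"])
  then have offdiag: "S k l = 0" if "k \<noteq> l" for k l
    using off_diagonal[of Y S k l] YS that assms(1) by blast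
  have "Y *v y = comb (\<lambda>i. S i i) *v y" for y
  proof -
    have "(\<Sum>k\<in>UNIV. (S k l * (v l \<bullet> y)) *\<^sub>R v k) = (S l l * (v l \<bullet> y)) *\<^sub>R v l" for l
    proof -
      have "(\<Sum>k\<in>UNIV. (S k l * (v l \<bullet> y)) *\<^sub>R v k)
          = (\<Sum>k\<in>UNIV. if k = l then (S l l * (v l \<bullet> y)) *\<^sub>R v l else 0)"
        by (intro sum.cong) (auto simp: offdiag)
      then show ?thesis
        by simp
    qed
    then show ?thesis
      by (simp add: YS comb_mult_vec)
  qed
  then have "Y = comb (\<lambda>i. S i i)"
    by (simp add: matrix_eq)
  \<comment> \<open>The diagonal coefficients are zero or values of the form of \<open>Y\<close> at
    dual vectors, hence nonnegative.\<close>
  then show ?thesis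
    by (intro exI[of _ "\<lambda>i. S i i"]) (auto simp: S_def I_def pos)
qed

text \<open>Only the support of \<open>c\<close> matters: this is the simplicial cone spanned by the
  \<open>outer (v i)\<close> with \<open>c i \<noteq> 0\<close>, which turns out to be the minimal
  face at \<open>comb c\<close> for nonnegative \<open>c\<close>.\<close>

definition gen_face :: "('s \<Rightarrow> real) \<Rightarrow> (real ^ 'm ^ 'm) set" where
  "gen_face c = {comb a | a. (\<forall>i. 0 \<le> a i) \<and> (\<forall>i. c i = 0 \<longrightarrow> a i = 0)}"

lemma comb_in_gen_face_iff:
  "comb a \<in> gen_face c \<longleftrightarrow> (\<forall>i. 0 \<le> a i) \<and> (\<forall>i. c i = 0 \<longrightarrow> a i = 0)"
  by (auto simp: gen_face_def comb_inject)

text \<open>If \<open>Y\<close> lies strictly between \<open>A\<close> and \<open>A'\<close>, a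
  vector at which the form of \<open>Y\<close> vanishes makes both nonnegative forms vanish. So
  \<open>A\<close> and \<open>A'\<close> inherit the kernel condition of
  \<open>in_cone_kernel_imp_comb\<close>, which puts them into the same cone.\<close>

lemma gen_face_face_of: "gen_face c face_of (L \<inter> psd_cone)"
  unfolding face_of_def
proof (intro conjI ballI impI)
  show "gen_face c \<subseteq> L \<inter> psd_cone"
    using comb_in_cone by (auto simp: gen_face_def)
  show "convex (gen_face c)"
    unfolding convex_def by (auto simp: gen_face_def comb_add comb_scaleR comb_inject)
next
  fix A A' Y
  assume A: "A \<in> L \<inter> psd_cone" "A' \<in> L \<inter> psd_cone" and Y: "Y \<in> gen_face c"
    and seg: "Y \<in> open_segment A A'"
  obtain a where a: "Y = comb a" "\<And>i. c i = 0 \<Longrightarrow> a i = 0"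
    using Y by (auto simp: gen_face_def)
  obtain u where u: "0 < u" "u < 1" "Y = (1 - u) *\<^sub>R A + u *\<^sub>R A'"
    using seg by (auto simp: in_segment)
  have "A *v y = 0 \<and> A' *v y = 0" if "\<And>i. c i \<noteq> 0 \<Longrightarrow> v i \<bullet> y = 0" for y
  proof -
    have "Y *v y = 0"
      unfolding a(1) comb_mult_vec using a(2) that by (intro sum.neutral) auto
    then have "(1 - u) *\<^sub>R (A *v y) + u *\<^sub>R (A' *v y) = 0"
      by (simp add: u(3) matrix_vector_mult_add_rdistrib scaleR_matrix_mult_vec)
    from arg_cong[OF this, of "\<lambda>z. y \<bullet> z"]
    have "(1 - u) * (y \<bullet> (A *v y)) + u * (y \<bullet> (A' *v y)) = 0"
      by (simp add: inner_add_right)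
    moreover have "0 \<le> y \<bullet> (A *v y)" "0 \<le> y \<bullet> (A' *v y)"
      using A by (auto simp: psd_cone_def)
    ultimately have "y \<bullet> (A *v y) = 0" "y \<bullet> (A' *v y) = 0"
      using u(1,2) by (simp_all add: add_nonneg_eq_0_iff)
    then show ?thesis
      using A psd_cone_mult_eq_0 by blast
  qed
  then have "\<exists>a. (\<forall>i. 0 \<le> a i) \<and> (\<forall>i. c i = 0 \<longrightarrow> a i = 0) \<and> A = comb a"
    "\<exists>a. (\<forall>i. 0 \<le> a i) \<and> (\<forall>i. c i = 0 \<longrightarrow> a i = 0) \<and> A' = comb a"
    using A by (auto intro!: in_cone_kernel_imp_comb)
  then show "A \<in> gen_face c" "A' \<in> gen_face c"
    by (auto simp: gen_face_def)
qed

text \<open>One inclusion holds because \<open>gen_face c\<close> is a face through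
  \<open>comb c\<close>. For the other, the coefficients of \<open>comb c\<close> in the support are
  positive, so the segment from any \<open>comb a\<close> of the cone to \<open>comb c\<close> can
  be prolonged beyond \<open>comb c\<close>; a face containing \<open>comb c\<close> then contains
  \<open>comb a\<close>.\<close>

lemma minface_comb:
  assumes "\<And>i. 0 \<le> c i"
  shows "minface (comb c) (L \<inter> psd_cone) = gen_face c"
proof
  show "minface (comb c) (L \<inter> psd_cone) \<subseteq> gen_face c"
    using gen_face_face_of comb_in_gen_face_iff[of c c] assms by (auto simp: minface_def)
  have "comb a \<in> F" if F: "F face_of (L \<inter> psd_cone)" "comb c \<in> F"
    and a: "\<And>i. 0 \<le> a i" "\<And>i. c i = 0 \<Longrightarrow> a i = 0" for F a
  \<comment> \<open>An open segment needs distinct endpoints, so equality is treated apart.\<close>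
  proof (cases "comb a = comb c")
    case False
    \<comment> \<open>The bound \<open>1/2\<close> keeps \<open>1 - \<delta>\<close> positive. The
      quotients keep \<open>c i - \<delta> * a i\<close> nonnegative, with \<open>a i + 1\<close>
      instead of \<open>a i\<close> to avoid dividing by zero.\<close>
    define \<delta> where "\<delta> = Min (insert (1/2) ((\<lambda>i. c i / (a i + 1)) ` {i. c i \<noteq> 0}))"
    have \<delta>_le: "\<delta> \<le> 1/2" "\<And>i. c i \<noteq> 0 \<Longrightarrow> \<delta> \<le> c i / (a i + 1)"
      unfolding \<delta>_def by (rule Min_le; simp)+
    have "\<delta> > 0"
    proof -
      have "c i > 0" if "c i \<noteq> 0" for i
        using assms[of i] that by simp
      moreover have "a i + 1 > 0" for i
        using a(1)[of i] by simp
      ultimately show ?thesis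
        unfolding \<delta>_def by (subst Min_gr_iff) auto
    qed
    have "\<delta> * a i \<le> c i" for i
    proof (cases "c i = 0")
      case False
      then have "\<delta> * (a i + 1) \<le> c i"
        using \<delta>_le(2)[of i] a(1)[of i] by (simp add: field_simps)
      then show ?thesis
        using \<open>\<delta> > 0\<close> by (simp add: algebra_simps)
    qed (use a in auto)
    then have \<delta>: "0 < \<delta>" "\<delta> < 1" "\<And>i. \<delta> * a i \<le> c i"
      using \<open>\<delta> > 0\<close> \<delta>_le(1) by auto
    define b where "b = (\<lambda>i. (c i - \<delta> * a i) / (1 - \<delta>))"
    have "comb c = (1 - \<delta>) *\<^sub>R comb b + \<delta> *\<^sub>R comb a"
      unfolding comb_add comb_scaleR comb_inject b_def using \<delta>(2) by auto
    moreover have "comb b \<noteq> comb a"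
    proof
      assume "comb b = comb a"
      then have "comb c = (1 - \<delta>) *\<^sub>R comb a + \<delta> *\<^sub>R comb a"
        using calculation by simp
      then show False
        using False by (simp add: algebra_simps)
    qed
    ultimately have "comb c \<in> open_segment (comb b) (comb a)"
      using \<delta> by (auto simp: in_segment)
    moreover have "comb b \<in> L \<inter> psd_cone"
      by (rule comb_in_cone) (use \<delta> in \<open>simp add: b_def\<close>)
    moreover have "comb a \<in> L \<inter> psd_cone"
      by (rule comb_in_cone) (rule a)
    ultimately show ?thesis
      using F by (meson face_ofD)
  qed (use F in simp)
  then show "gen_face c \<subseteq> minface (comb c) (L \<inter> psd_cone)"
    by (auto simp: minface_def gen_face_def)
qed

section \<open>Minimisers on the trace one section and runs of the algorithm\<close>

lemma trace_comb: "trace (comb a) = (\<Sum>i\<in>UNIV. a i * (norm (v i))\<^sup>2)"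
  by (simp add: comb_def trace_sum trace_scaleR trace_outer)

text \<open>The weights \<open>a i * (norm (v i))\<^sup>2\<close> add up to the trace by
  \<open>trace_comb\<close>, so for nonnegative \<open>a\<close> and trace one this is a convex
  combination of the values at the vertices.\<close>

lemma trace_mult_comb: "trace (B ** comb a) = (\<Sum>i\<in>UNIV. a i * (norm (v i))\<^sup>2 * trace (B ** vertex i))"
proof -
  have "(norm (v i))\<^sup>2 * trace (B ** vertex i) = trace (B ** outer (v i))" for i
    using norm_v_pos[of i] by (simp add: vertex_def matrix_mult_scaleR_right trace_scaleR)
  then show ?thesis
    by (simp add: comb_def matrix_mult_sum_right matrix_mult_scaleR_right trace_sum trace_scaleR mult.assoc)
qed

lemma vertex_in_gen_face_iff: "vertex i \<in> gen_face c \<longleftrightarrow> c i \<noteq> 0"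
  using norm_v_pos[of i] by (auto simp: vertex_eq_comb comb_in_gen_face_iff)

lemma trace_vertex: "trace (vertex i) = 1"
  using norm_v_pos[of i] by (simp add: vertex_def trace_scaleR trace_outer)

text \<open>The numbers \<open>p j\<close> are barycentric coordinates in the trace one simplex. A
  point other than \<open>vertex i\<close> gives positive weight to another vertex, where the value
  is strictly larger.\<close>

lemma arg_min_gen_face:
  assumes "c i \<noteq> 0" "\<And>j. c j \<noteq> 0 \<Longrightarrow> j \<noteq> i \<Longrightarrow> trace (B ** vertex i) < trace (B ** vertex j)"
  shows "is_arg_min (\<lambda>Y. trace (B ** Y)) (\<lambda>Y. Y \<in> gen_face c \<and> trace Y = 1) M \<longleftrightarrow> M = vertex i"
proof -
  have strict: "trace (B ** vertex i) < trace (B ** Y)"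
    if Y: "Y \<in> gen_face c" "trace Y = 1" "Y \<noteq> vertex i" for Y
  proof -
    obtain a where a: "Y = comb a" "\<And>j. 0 \<le> a j" "\<And>j. c j = 0 \<Longrightarrow> a j = 0"
      using Y(1) by (auto simp: gen_face_def)
    define p where "p = (\<lambda>j. a j * (norm (v j))\<^sup>2)"
    have p: "0 \<le> p j" "(\<Sum>j\<in>UNIV. p j) = 1" "trace (B ** Y) = (\<Sum>j\<in>UNIV. p j * trace (B ** vertex j))" for j
      using a Y(2) by (auto simp: p_def trace_comb trace_mult_comb)
    have le: "p j * trace (B ** vertex i) \<le> p j * trace (B ** vertex j)" for j
    proof (cases "c j = 0 \<or> j = i")
      case False
      then show ?thesis
        using assms(2)[of j] p(1)[of j] by (intro mult_left_mono) auto
    qed (use a in \<open>auto simp: p_def\<close>)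
    have "\<exists>j. j \<noteq> i \<and> p j \<noteq> 0"
    proof (rule ccontr)
      assume "\<not> ?thesis"
      then have z: "j \<noteq> i \<Longrightarrow> p j = 0" for j
        by auto
      then have "(\<Sum>j\<in>UNIV. p j) = (\<Sum>j\<in>UNIV. if j = i then p i else 0)"
        by (intro sum.cong) auto
      with p(2) have "p i = 1"
        by simp
      then have "a j = (if j = i then 1 / (norm (v i))\<^sup>2 else 0)" for j
        using z[of j] norm_v_pos[of j] norm_v_pos[of i] by (auto simp: p_def field_simps)
      then show False
        using Y(3) by (simp add: a(1) vertex_eq_comb comb_inject fun_eq_iff)
    qed
    then obtain j where j: "j \<noteq> i" "p j > 0"
      using p(1) by (metis order_le_less)
    then have "c j \<noteq> 0"
      using a(3) by (auto simp: p_def)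
    have "trace (B ** vertex i) = (\<Sum>j\<in>UNIV. p j * trace (B ** vertex i))"
      by (simp add: sum_distrib_right[symmetric] p(2))
    also have "\<dots> < (\<Sum>j\<in>UNIV. p j * trace (B ** vertex j))"
      by (rule sum_strict_mono_strong[of _ j]) (use le j \<open>c j \<noteq> 0\<close> assms(2) in auto)
    finally show ?thesis
      by (simp add: p(3))
  qed
  have "vertex i \<in> gen_face c \<and> trace (vertex i) = 1"
    using assms(1) by (simp add: vertex_in_gen_face_iff trace_vertex)
  then show ?thesis
    using strict unfolding is_arg_min_def by (metis less_asym less_irrefl)
qed

text \<open>Subtracting \<open>\<tau>\<close> times \<open>vertex i\<close> lowers only coefficient
  \<open>i\<close>, by \<open>\<tau> / (norm (v i))\<^sup>2\<close>, so the face is left exactly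
  when this coefficient turns negative. At the supremum it is zero.\<close>

lemma erd_step_comb:
  assumes "\<And>j. 0 \<le> c j" "c i \<noteq> 0"
    "\<And>j. c j \<noteq> 0 \<Longrightarrow> j \<noteq> i \<Longrightarrow> trace (B ** vertex i) < trace (B ** vertex j)"
  shows "erd_step (L \<inter> psd_cone) B (comb c) t M X' \<longleftrightarrow>
    t = c i * (norm (v i))\<^sup>2 \<and> M = vertex i \<and> X' = comb (c(i := 0))"
proof -
  define t0 where "t0 = c i * (norm (v i))\<^sup>2"
  have diff: "comb c - \<tau> *\<^sub>R vertex i = comb (\<lambda>j. c j - \<tau> * (if j = i then 1 / (norm (v i))\<^sup>2 else 0))" for \<tau>
    by (simp only: vertex_eq_comb comb_scaleR comb_diff)
  have in_face: "comb c - \<tau> *\<^sub>R vertex i \<in> gen_face c \<longleftrightarrow> \<tau> \<le> t0" for \<tau>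
    unfolding diff comb_in_gen_face_iff t0_def
    using assms(1,2) norm_v_pos[of i] by (auto simp: field_simps)
  have "{\<tau>. 0 \<le> \<tau> \<and> comb c - \<tau> *\<^sub>R vertex i \<in> gen_face c} = {0..t0}"
    unfolding in_face by auto
  moreover have "0 \<le> t0"
    using assms(1) by (simp add: t0_def)
  ultimately have Sup: "Sup {\<tau>. 0 \<le> \<tau> \<and> comb c - \<tau> *\<^sub>R vertex i \<in> gen_face c} = t0"
    by simp
  have "comb c - t0 *\<^sub>R vertex i = comb (c(i := 0))"
    unfolding diff comb_inject t0_def using norm_v_pos[of i] by auto
  moreover have "comb c \<noteq> 0"
    using assms(2) by (auto simp: comb_eq_0_iff)
  moreover have "is_arg_min (\<lambda>Y. trace (B ** Y)) (\<lambda>Y. Y \<in> gen_face c \<and> trace Y = 1) M \<longleftrightarrow> M = vertex i"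
    using assms(2,3) by (rule arg_min_gen_face)
  ultimately show ?thesis
    unfolding erd_step_def minface_comb[OF assms(1)]
    using Sup by (auto simp: t0_def)
qed

text \<open>A minimiser over the finite support exists, and injectivity makes it strict, so the step
  has exactly one outcome.\<close>

lemma erd_step_comb_cases:
  assumes "\<And>j. 0 \<le> c j" "comb c \<noteq> 0" "inj (\<lambda>i. trace (B ** vertex i))"
  shows "\<exists>i. c i \<noteq> 0 \<and> (\<forall>t M X'. erd_step (L \<inter> psd_cone) B (comb c) t M X' \<longleftrightarrow>
    t = c i * (norm (v i))\<^sup>2 \<and> M = vertex i \<and> X' = comb (c(i := 0)))"
proof -
  have "{j. c j \<noteq> 0} \<noteq> {}"
    using assms(2) by (auto simp: comb_eq_0_iff)
  then obtain i where i: "c i \<noteq> 0" "\<And>j. c j \<noteq> 0 \<Longrightarrow> trace (B ** vertex i) \<le> trace (B ** vertex j)"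
    using ex_is_arg_min_if_finite[of "{j. c j \<noteq> 0}" "\<lambda>j. trace (B ** vertex j)"]
    by (auto simp: is_arg_min_linorder)
  then have "trace (B ** vertex i) < trace (B ** vertex j)" if "c j \<noteq> 0" "j \<noteq> i" for j
    using that assms(3) by (metis injD order_le_less)
  then show ?thesis
    by (intro exI[of _ i] conjI allI erd_step_comb assms(1) i(1))
qed

text \<open>Loop invariant: \<open>r\<close> steps erase the coefficients of \<open>r\<close>
  distinct indices. They are distinct because each step picks an index whose current coefficient is
  nonzero.\<close>

lemma erd_run_comb:
  assumes "\<forall>i. 0 < c i" "\<forall>k\<ge>1. inj (\<lambda>i. trace (B k ** vertex i))"
    "erd_run (L \<inter> psd_cone) (comb c) B r Xs t M"
  shows "\<exists>\<sigma>. inj_on \<sigma> {1..r} \<and> Xs (r + 1) = comb (\<lambda>i. if i \<in> \<sigma> ` {1..r} then 0 else c i) \<and>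
    (\<forall>k\<in>{1..r}. t k = c (\<sigma> k) * (norm (v (\<sigma> k)))\<^sup>2 \<and> M k = vertex (\<sigma> k))"
  using assms(3)
proof (induction r)
  case 0
  then show ?case
    by (simp add: erd_run_def)
next
  case (Suc r)
  then have "erd_run (L \<inter> psd_cone) (comb c) B r Xs t M"
    by (simp add: erd_run_def)
  then obtain \<sigma> where \<sigma>: "inj_on \<sigma> {1..r}" "Xs (r + 1) = comb (\<lambda>i. if i \<in> \<sigma> ` {1..r} then 0 else c i)"
    "\<forall>k\<in>{1..r}. t k = c (\<sigma> k) * (norm (v (\<sigma> k)))\<^sup>2 \<and> M k = vertex (\<sigma> k)"
    using Suc.IH by blast
  define c' where "c' = (\<lambda>i. if i \<in> \<sigma> ` {1..r} then 0 else c i)"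
  have step: "erd_step (L \<inter> psd_cone) (B (Suc r)) (comb c') (t (Suc r)) (M (Suc r)) (Xs (Suc r + 1))"
  proof -
    have "erd_step (L \<inter> psd_cone) (B (Suc r)) (Xs (Suc r)) (t (Suc r)) (M (Suc r)) (Xs (Suc r + 1))"
      using Suc.prems by (simp add: erd_run_def)
    then show ?thesis
      using \<sigma>(2) by (simp add: c'_def)
  qed
  then have "comb c' \<noteq> 0"
    by (simp add: erd_step_def)
  moreover have "0 \<le> c' j" for j
    using assms(1) by (simp add: c'_def less_imp_le)
  moreover have "inj (\<lambda>i. trace (B (Suc r) ** vertex i))"
    using assms(2) by simp
  ultimately obtain i where i: "c' i \<noteq> 0" "t (Suc r) = c' i * (norm (v i))\<^sup>2"
    "M (Suc r) = vertex i" "Xs (Suc r + 1) = comb (c'(i := 0))"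
    using erd_step_comb_cases[of c' "B (Suc r)"] step by blast
  then have i': "i \<notin> \<sigma> ` {1..r}" "c' i = c i"
    by (auto simp: c'_def)
  define \<sigma>' where "\<sigma>' = \<sigma>(Suc r := i)"
  have eq: "\<sigma>' k = \<sigma> k" if "k \<in> {1..r}" for k
    using that by (auto simp: \<sigma>'_def)
  have ivl: "{1..Suc r} = insert (Suc r) {1..r}"
    by auto
  have img: "\<sigma>' ` {1..Suc r} = insert i (\<sigma> ` {1..r})"
    unfolding ivl using eq by (auto simp: \<sigma>'_def)
  have "inj_on \<sigma>' {1..r}"
    using \<sigma>(1) by (rule inj_on_cong[THEN iffD2, rotated]) (rule eq)
  then have "inj_on \<sigma>' {1..Suc r}"
    unfolding ivl using i'(1) eq by (auto simp: \<sigma>'_def)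
  moreover have "Xs (Suc r + 1) = comb (\<lambda>j. if j \<in> \<sigma>' ` {1..Suc r} then 0 else c j)"
    unfolding i(4) comb_inject img by (auto simp: c'_def)
  moreover have "\<forall>k\<in>{1..Suc r}. t k = c (\<sigma>' k) * (norm (v (\<sigma>' k)))\<^sup>2 \<and> M k = vertex (\<sigma>' k)"
    unfolding ivl using \<sigma>(3) eq i i' by (auto simp: \<sigma>'_def)
  ultimately show ?case
    by blast
qed

lemma erd_terminates_comb:
  assumes "\<forall>i. 0 < c i" "\<forall>k\<ge>1. inj (\<lambda>i. trace (B k ** vertex i))"
  shows "erd_terminates (L \<inter> psd_cone) (comb c) B"
  unfolding erd_terminates_def
proof (intro conjI allI impI notI)
  fix r Xs t M
  assume run: "erd_run (L \<inter> psd_cone) (comb c) B r Xs t M" and nz: "Xs (r + 1) \<noteq> 0"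
  obtain \<sigma> where \<sigma>: "Xs (r + 1) = comb (\<lambda>i. if i \<in> \<sigma> ` {1..r} then 0 else c i)"
    using erd_run_comb[OF assms run] by blast
  define c' where "c' = (\<lambda>i. if i \<in> \<sigma> ` {1..r} then 0 else c i)"
  have "\<And>j. 0 \<le> c' j"
    using assms(1) by (simp add: c'_def less_imp_le)
  moreover have "comb c' \<noteq> 0" "inj (\<lambda>i. trace (B (r + 1) ** vertex i))"
    using nz assms(2) \<sigma> by (simp_all add: c'_def)
  ultimately show "\<exists>t' M' X'. erd_step (L \<inter> psd_cone) (B (r + 1)) (Xs (r + 1)) t' M' X'"
    unfolding \<sigma> c'_def[symmetric] using erd_step_comb_cases by blast
next
  assume "\<exists>Xs t M. \<forall>r. erd_run (L \<inter> psd_cone) (comb c) B r Xs t M"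
  \<comment> \<open>One iteration more than there are indices contradicts the injectivity of
    \<open>\<sigma>\<close>.\<close>
  then obtain Xs t M where "erd_run (L \<inter> psd_cone) (comb c) B (CARD('s) + 1) Xs t M"
    by blast
  then obtain \<sigma> :: "nat \<Rightarrow> 's" where "inj_on \<sigma> {1..CARD('s) + 1}"
    using erd_run_comb[OF assms] by blast
  then have "card {1..CARD('s) + 1} \<le> CARD('s)"
    by (metis card_image card_mono finite_code subset_UNIV)
  then show False
    by simp
qed

text \<open>As all \<open>c i\<close> are positive, a zero iterate means that every index has been
  erased, so the injective \<open>\<sigma>\<close> is onto.\<close>

lemma erd_output_comb:
  assumes "\<forall>i. 0 < c i" "\<forall>k\<ge>1. inj (\<lambda>i. trace (B k ** vertex i))"
    and "erd_output (L \<inter> psd_cone) (comb c) B r t M"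
  shows "r = CARD('s)"
    and "\<exists>\<sigma>. bij_betw \<sigma> {1..CARD('s)} UNIV \<and>
      (\<forall>k\<in>{1..CARD('s)}. t k = c (\<sigma> k) * (norm (v (\<sigma> k)))\<^sup>2 \<and> M k = vertex (\<sigma> k))"
proof -
  obtain Xs where run: "erd_run (L \<inter> psd_cone) (comb c) B r Xs t M" and final: "Xs (r + 1) = 0"
    using assms(3) by (auto simp: erd_output_def)
  obtain \<sigma> where \<sigma>: "inj_on \<sigma> {1..r}"
    "Xs (r + 1) = comb (\<lambda>i. if i \<in> \<sigma> ` {1..r} then 0 else c i)"
    "\<forall>k\<in>{1..r}. t k = c (\<sigma> k) * (norm (v (\<sigma> k)))\<^sup>2 \<and> M k = vertex (\<sigma> k)"
    using erd_run_comb[OF assms(1,2) run] by blast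
  have "comb (\<lambda>i. if i \<in> \<sigma> ` {1..r} then 0 else c i) = 0"
    using \<sigma>(2) final by simp
  then have "i \<in> \<sigma> ` {1..r}" for i
    using assms(1) unfolding comb_eq_0_iff by (metis less_irrefl)
  then have "bij_betw \<sigma> {1..r} UNIV"
    using \<sigma>(1) by (auto simp: bij_betw_def)
  moreover from this show "r = CARD('s)"
    using bij_betw_same_card by fastforce
  ultimately show "\<exists>\<sigma>. bij_betw \<sigma> {1..CARD('s)} UNIV \<and>
      (\<forall>k\<in>{1..CARD('s)}. t k = c (\<sigma> k) * (norm (v (\<sigma> k)))\<^sup>2 \<and> M k = vertex (\<sigma> k))"
    using \<sigma>(3) by blast
qed

end

section \<open>Quadrics through the Veronese variety\<close>

text \<open>Stars and bars: listing the values along a fixed enumeration of the type turns the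
  functions into lists of given length and sum.\<close>

lemma card_functions_sum_eq:
  "card {\<alpha> :: 'i::finite \<Rightarrow> nat. (\<Sum>i\<in>UNIV. \<alpha> i) = k} = (CARD('i) + k - 1) choose k"
proof -
  obtain xs :: "'i list" where xs: "set xs = UNIV" "distinct xs"
    using finite_distinct_list[of "UNIV :: 'i set"] by auto
  then have len: "length xs = CARD('i)"
    using distinct_card by fastforce
  have "bij_betw (\<lambda>\<alpha>. map \<alpha> xs) {\<alpha>. (\<Sum>i\<in>UNIV. \<alpha> i) = k} {l::nat list. length l = CARD('i) \<and> sum_list l = k}"
  proof (rule bij_betwI')
    fix \<alpha> \<beta> :: "'i \<Rightarrow> nat"
    show "(map \<alpha> xs = map \<beta> xs) = (\<alpha> = \<beta>)"
      using xs(1) by (auto simp: fun_eq_iff)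
  next
    fix \<alpha> :: "'i \<Rightarrow> nat"
    assume "\<alpha> \<in> {\<alpha>. (\<Sum>i\<in>UNIV. \<alpha> i) = k}"
    then show "map \<alpha> xs \<in> {l. length l = CARD('i) \<and> sum_list l = k}"
      using len xs by (simp add: sum_list_distinct_conv_sum_set)
  next
    fix l :: "nat list"
    assume l: "l \<in> {l. length l = CARD('i) \<and> sum_list l = k}"
    define \<alpha> where "\<alpha> = (\<lambda>i. the (map_of (zip xs l) i))"
    have "map \<alpha> xs = l"
    proof (rule nth_equalityI)
      fix n
      assume "n < length (map \<alpha> xs)"
      then show "map \<alpha> xs ! n = l ! n"
        using l len xs(2) by (simp add: \<alpha>_def map_of_zip_nth)
    qed (use l len in simp)
    moreover from this have "(\<Sum>i\<in>UNIV. \<alpha> i) = k"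
      using l xs by (metis (mono_tags, lifting) mem_Collect_eq sum_list_distinct_conv_sum_set)
    ultimately show "\<exists>\<alpha>\<in>{\<alpha>. (\<Sum>i\<in>UNIV. \<alpha> i) = k}. l = map \<alpha> xs"
      by blast
  qed
  then show ?thesis
    by (simp add: bij_betw_same_card card_length_sum_list add.commute)
qed

lemma finite_functions_sum_eq: "finite {\<alpha> :: 'i::finite \<Rightarrow> nat. (\<Sum>i\<in>UNIV. \<alpha> i) = k}"
proof (rule finite_subset)
  show "{\<alpha> :: 'i \<Rightarrow> nat. (\<Sum>i\<in>UNIV. \<alpha> i) = k} \<subseteq> UNIV \<rightarrow>\<^sub>E {..k}"
  proof
    fix \<alpha> :: "'i \<Rightarrow> nat"
    assume "\<alpha> \<in> {\<alpha>. (\<Sum>i\<in>UNIV. \<alpha> i) = k}"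
    then have "\<alpha> i \<le> k" for i
      using member_le_sum[of i UNIV \<alpha>] by simp
    then show "\<alpha> \<in> UNIV \<rightarrow>\<^sub>E {..k}"
      by (simp add: PiE_iff)
  qed
qed (intro finite_PiE; simp)

lemma card_multi_index: "CARD(('n::finite, 'd::finite) multi_index) = (CARD('n) + CARD('d)) choose CARD('d)"
  using type_definition.card[OF type_definition_multi_index]
  by (simp add: card_functions_sum_eq)

text \<open>Unordered pairs index the independent entries of a symmetric matrix; they are the
  singletons and the two-element sets.\<close>

lemma card_unordered_pairs:
  "2 * card {p :: 'm::finite set. \<exists>i j. p = {i, j}} = CARD('m) * (CARD('m) + 1)"
proof -
  have "{p :: 'm set. \<exists>i j. p = {i, j}} = {p. p \<subseteq> UNIV \<and> card p = 1} \<union> {p. p \<subseteq> UNIV \<and> card p = 2}"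
  proof (intro set_eqI iffI)
    fix p :: "'m set"
    assume "p \<in> {p. \<exists>i j. p = {i, j}}"
    then obtain i j where "p = {i, j}"
      by blast
    then show "p \<in> {p. p \<subseteq> UNIV \<and> card p = 1} \<union> {p. p \<subseteq> UNIV \<and> card p = 2}"
      by (cases "i = j") auto
  next
    fix p :: "'m set"
    assume "p \<in> {p. p \<subseteq> UNIV \<and> card p = 1} \<union> {p. p \<subseteq> UNIV \<and> card p = 2}"
    then have "(\<exists>i. p = {i, i}) \<or> (\<exists>i j. p = {i, j})"
      by (auto simp: card_1_singleton_iff card_2_iff)
    then show "p \<in> {p. \<exists>i j. p = {i, j}}"
      by blast
  qed
  also have "card \<dots> = CARD('m) + (CARD('m) choose 2)"
    by (subst card_Un_disjoint) (auto simp: n_subsets[of "UNIV :: 'm set", simplified])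
  also have "2 * (CARD('m) + (CARD('m) choose 2)) = CARD('m) * (CARD('m) + 1)"
    by (cases "CARD('m)") (auto simp: choose_two algebra_simps)
  finally show ?thesis .
qed

lemma real_polynomial_function_monomials:
  "real_polynomial_function (\<lambda>x :: (real \<times> (real ^ 'n::finite)) ^ 's::finite. monomials (snd (x $ k)) $ \<alpha>)"
proof -
  have "bounded_linear (\<lambda>x :: (real \<times> (real ^ 'n)) ^ 's. snd (x $ k) $ l)" for l
    by (intro bounded_linear_compose[OF bounded_linear_vec_nth]
        bounded_linear_compose[OF bounded_linear_snd] bounded_linear_vec_nth)
  then show ?thesis
    unfolding monomials_nth
    by (intro real_polynomial_function_prod real_polynomial_function_power real_polynomial_function.intros(1)) auto
qed

text \<open>Translates between unknowns indexed by unordered pairs and positions in a symmetric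
  matrix: the coefficient of an unknown collects all positions that \<open>f\<close> sends to
  it.\<close>

lemma sum_unordered_pairs:
  fixes c :: "'b::finite \<Rightarrow> real"
  assumes "finite J" "\<And>\<beta>. f \<beta> \<in> J"
  shows "(\<Sum>p\<in>J. (\<Sum>\<beta>\<in>UNIV. if f \<beta> = p then c \<beta> else 0) * q p) = (\<Sum>\<beta>\<in>UNIV. c \<beta> * q (f \<beta>))"
proof -
  have "(\<Sum>p\<in>J. (\<Sum>\<beta>\<in>UNIV. if f \<beta> = p then c \<beta> else 0) * q p)
      = (\<Sum>\<beta>\<in>UNIV. \<Sum>p\<in>J. if f \<beta> = p then c \<beta> * q p else 0)"
    unfolding sum_distrib_right by (subst sum.swap) (intro sum.cong refl, simp)
  also have "\<dots> = (\<Sum>\<beta>\<in>UNIV. c \<beta> * q (f \<beta>))"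
    using assms by (intro sum.cong refl) simp
  finally show ?thesis .
qed

text \<open>The entries of \<open>Y\<close> are constant on the pairs with a given exponent sum, so
  grouping by \<open>\<gamma>\<close> leaves multiples of the sums that vanish by
  hypothesis.\<close>

lemma hankel_orthogonal:
  fixes Q Y :: "real ^ ('n, 'd) multi_index ^ ('n::finite, 'd::finite) multi_index"
  assumes Y: "Y \<in> hankel"
    and Q: "\<And>\<gamma> :: 'n option \<Rightarrow> nat. (\<Sum>i\<in>UNIV. \<gamma> i) = 2 * CARD('d) \<Longrightarrow>
      (\<Sum>ab\<in>{ab. (\<lambda>i. expo (fst ab) i + expo (snd ab) i) = \<gamma>}. Q $ fst ab $ snd ab) = 0"
  shows "(\<Sum>\<alpha>\<in>UNIV. \<Sum>\<beta>\<in>UNIV. Q $ \<alpha> $ \<beta> * Y $ \<alpha> $ \<beta>) = 0"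
proof -
  define \<Gamma> where "\<Gamma> = {\<gamma> :: 'n option \<Rightarrow> nat. (\<Sum>i\<in>UNIV. \<gamma> i) = 2 * CARD('d)}"
  define g where "g = (\<lambda>(\<alpha> :: ('n, 'd) multi_index, \<beta> :: ('n, 'd) multi_index) i. expo \<alpha> i + expo \<beta> i)"
  have "g ab \<in> \<Gamma>" for ab
    using expo[of "fst ab"] expo[of "snd ab"] by (auto simp: g_def \<Gamma>_def sum.distrib split: prod.splits)
  then have img: "g ` UNIV \<subseteq> \<Gamma>"
    by blast
  have "(\<Sum>\<alpha>\<in>UNIV. \<Sum>\<beta>\<in>UNIV. Q $ \<alpha> $ \<beta> * Y $ \<alpha> $ \<beta>)
      = (\<Sum>ab\<in>UNIV. Q $ fst ab $ snd ab * Y $ fst ab $ snd ab)"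
    by (simp add: sum.cartesian_product split_beta)
  also have "\<dots> = (\<Sum>\<gamma>\<in>\<Gamma>. \<Sum>ab\<in>{ab\<in>UNIV. g ab = \<gamma>}. Q $ fst ab $ snd ab * Y $ fst ab $ snd ab)"
    by (rule sum.group[symmetric]) (use img in \<open>simp_all add: \<Gamma>_def finite_functions_sum_eq\<close>)
  also have "\<dots> = 0"
  proof (rule sum.neutral, rule ballI)
    fix \<gamma>
    assume "\<gamma> \<in> \<Gamma>"
    then have zero: "(\<Sum>ab\<in>{ab\<in>UNIV. g ab = \<gamma>}. Q $ fst ab $ snd ab) = 0"
      using Q[of \<gamma>] by (simp add: \<Gamma>_def g_def split_beta)
    show "(\<Sum>ab\<in>{ab\<in>UNIV. g ab = \<gamma>}. Q $ fst ab $ snd ab * Y $ fst ab $ snd ab) = 0"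
    proof (cases "\<exists>ab0. g ab0 = \<gamma>")
      case True
      then obtain ab0 where ab0: "g ab0 = \<gamma>" ..
      have "Y $ fst ab $ snd ab = Y $ fst ab0 $ snd ab0" if "g ab = \<gamma>" for ab
      proof -
        have "g ab = g ab0"
          using that ab0 by simp
        then have "\<forall>i. expo (fst ab) i + expo (snd ab) i = expo (fst ab0) i + expo (snd ab0) i"
          by (simp add: g_def split_beta fun_eq_iff)
        then show ?thesis
          using Y by (simp add: hankel_def)
      qed
      then have "(\<Sum>ab\<in>{ab\<in>UNIV. g ab = \<gamma>}. Q $ fst ab $ snd ab * Y $ fst ab $ snd ab)
          = (\<Sum>ab\<in>{ab\<in>UNIV. g ab = \<gamma>}. Q $ fst ab $ snd ab * Y $ fst ab0 $ snd ab0)"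
        by (intro sum.cong) auto
      also have "\<dots> = (\<Sum>ab\<in>{ab\<in>UNIV. g ab = \<gamma>}. Q $ fst ab $ snd ab) * Y $ fst ab0 $ snd ab0"
        by (rule sum_distrib_right[symmetric])
      finally show ?thesis
        using zero by simp
    next
      case False
      then have "{ab \<in> UNIV. g ab = \<gamma>} = {}"
        by blast
      then show ?thesis
        by (simp only: sum.empty)
    qed
  qed
  finally show ?thesis .
qed

text \<open>The solutions of the linear system for \<open>Q\<close> are sought in the ring \<open>R\<close> of polynomials that do not
  involve the points \<open>i\<close> and \<open>j\<close>. These two points can then be moved freely without changing \<open>Q\<close>, and
  as the monomial vectors span the space, \<open>Q \<noteq> 0\<close> does not vanish on some pair of them.\<close>

lemma generic_separating_quadric:
  fixes i j :: "'s::finite"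
  assumes "i \<noteq> j"
    and bound: "((CARD('n::finite) + 2 * CARD('d::finite)) choose (2 * CARD('d)))
      + (CARD('s) - 2) * CARD(('n, 'd) multi_index) < card {p :: ('n, 'd) multi_index set. \<exists>\<alpha> \<beta>. p = {\<alpha>, \<beta>}}"
  shows "\<exists>F :: (real \<times> (real ^ 'n)) ^ 's \<Rightarrow> real. real_polynomial_function F \<and> (\<exists>x. F x \<noteq> 0) \<and>
    (\<forall>x. F x \<noteq> 0 \<longrightarrow> (\<exists>Q :: real ^ ('n, 'd) multi_index ^ ('n, 'd) multi_index. transpose Q = Q \<and>
      (\<forall>Y\<in>hankel. (\<Sum>\<alpha>\<in>UNIV. \<Sum>\<beta>\<in>UNIV. Q $ \<alpha> $ \<beta> * Y $ \<alpha> $ \<beta>) = 0) \<and>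
      (\<forall>k. k \<noteq> i \<longrightarrow> k \<noteq> j \<longrightarrow> Q *v monomials (snd (x $ k)) = 0) \<and>
      monomials (snd (x $ i)) \<bullet> (Q *v monomials (snd (x $ j))) \<noteq> 0))"
proof -
  define J where "J = {p :: ('n, 'd) multi_index set. \<exists>\<alpha> \<beta>. p = {\<alpha>, \<beta>}}"
  define \<Gamma> where "\<Gamma> = {\<gamma> :: 'n option \<Rightarrow> nat. (\<Sum>i\<in>UNIV. \<gamma> i) = 2 * CARD('d)}"
  define m where "m = (\<lambda>(x :: (real \<times> (real ^ 'n)) ^ 's) k. monomials (snd (x $ k)) :: real ^ ('n, 'd) multi_index)"
  define R where "R = {f :: (real \<times> (real ^ 'n)) ^ 's \<Rightarrow> real. real_polynomial_function f \<and>
    (\<forall>x y. (\<forall>k. k \<noteq> i \<longrightarrow> k \<noteq> j \<longrightarrow> x $ k = y $ k) \<longrightarrow> f x = f y)}"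
  \<comment> \<open>\<open>Inl \<gamma>\<close> is the equation that the entries of \<open>Q\<close>
    with exponent sum \<open>\<gamma>\<close> add up to zero, \<open>Inr (l, \<alpha>)\<close> the
    equation that entry \<open>\<alpha>\<close> of \<open>Q *v m x l\<close> is zero.\<close>
  define K :: "(('n option \<Rightarrow> nat) + 's \<times> ('n, 'd) multi_index) set"
    where "K = Inl ` \<Gamma> \<union> Inr ` ((UNIV - {i, j}) \<times> UNIV)"
  \<comment> \<open>The value zero for \<open>l = i\<close> and \<open>l = j\<close> keeps every
    coefficient in \<open>R\<close>; the rows concerned lie outside \<open>K\<close>.\<close>
  define A :: "('n option \<Rightarrow> nat) + 's \<times> ('n, 'd) multi_index \<Rightarrow> ('n, 'd) multi_index set \<Rightarrow>
      (real \<times> (real ^ 'n)) ^ 's \<Rightarrow> real"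
    where "A = (\<lambda>k p x. case k of
      Inl \<gamma> \<Rightarrow> \<Sum>ab\<in>UNIV. if {fst ab, snd ab} = p then if (\<lambda>i. expo (fst ab) i + expo (snd ab) i) = \<gamma> then 1 else 0 else 0
    | Inr (l, \<alpha>) \<Rightarrow> \<Sum>\<beta>\<in>UNIV. if {\<alpha>, \<beta>} = p then if l = i \<or> l = j then 0 else m x l $ \<beta> else 0)"
  have pair_in_J: "{\<alpha>, \<beta>} \<in> J" for \<alpha> \<beta>
    by (auto simp: J_def)
  have Rpoly: "real_polynomial_function f" if "f \<in> R" for f
    using that by (simp add: R_def)
  have RD: "f x = f y" if "f \<in> R" "\<forall>k. k \<noteq> i \<longrightarrow> k \<noteq> j \<longrightarrow> x $ k = y $ k" for f x y
    using that unfolding R_def by blast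
  have RI: "f \<in> R" if "real_polynomial_function f"
    "\<And>x y. \<forall>k. k \<noteq> i \<longrightarrow> k \<noteq> j \<longrightarrow> x $ k = y $ k \<Longrightarrow> f x = f y" for f
    using that unfolding R_def by blast
  have "\<exists>q. (\<forall>p. q p \<in> R) \<and> (\<exists>p\<in>J. \<exists>x. q p x \<noteq> 0) \<and> (\<forall>k\<in>K. \<forall>x. (\<Sum>p\<in>J. A k p x * q p x) = 0)"
  proof (rule homogeneous_system_nontrivial_solution)
    show "(\<lambda>_. c) \<in> R" for c
      by (auto simp: R_def)
    show "(\<lambda>x. f x + g x) \<in> R" if "f \<in> R" "g \<in> R" for f g
    proof (rule RI)
      show "f x + g x = f y + g y" if "\<forall>k. k \<noteq> i \<longrightarrow> k \<noteq> j \<longrightarrow> x $ k = y $ k" for x y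
        using RD[OF \<open>f \<in> R\<close> that] RD[OF \<open>g \<in> R\<close> that] by simp
    qed (intro real_polynomial_function.intros(3) Rpoly that)
    show "(\<lambda>x. f x * g x) \<in> R" if "f \<in> R" "g \<in> R" for f g
    proof (rule RI)
      show "f x * g x = f y * g y" if "\<forall>k. k \<noteq> i \<longrightarrow> k \<noteq> j \<longrightarrow> x $ k = y $ k" for x y
        using RD[OF \<open>f \<in> R\<close> that] RD[OF \<open>g \<in> R\<close> that] by simp
    qed (intro real_polynomial_function.intros(4) Rpoly that)
    show "\<exists>z. f z * g z \<noteq> 0" if "f \<in> R" "g \<in> R" "f x \<noteq> 0" "g y \<noteq> 0" for f g x y
      using that by (intro real_polynomial_function_mult_nonzero Rpoly)
    show "finite K"
      by (simp add: K_def \<Gamma>_def finite_functions_sum_eq)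
    show "finite J"
      by simp
    have "card K = card \<Gamma> + card ((UNIV - {i, j}) \<times> (UNIV :: ('n, 'd) multi_index set))"
      unfolding K_def by (subst card_Un_disjoint) (auto simp: card_image \<Gamma>_def finite_functions_sum_eq)
    also have "\<dots> = ((CARD('n) + 2 * CARD('d)) choose (2 * CARD('d))) + (CARD('s) - 2) * CARD(('n, 'd) multi_index)"
      using \<open>i \<noteq> j\<close> by (simp add: \<Gamma>_def card_functions_sum_eq card_cartesian_product card_Diff_subset)
    finally show "card K < card J"
      using bound by (simp add: J_def)
    show "A k p \<in> R" for k p
    proof (cases k)
      case (Inl \<gamma>)
      then have "A k p = (\<lambda>_. A k p 0)"
        by (simp add: A_def)
      moreover have "(\<lambda>_. A k p 0) \<in> R"
        by (auto simp: R_def)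
      ultimately show ?thesis
        by simp
    next
      case (Inr la)
      obtain l \<alpha> where la: "la = (l, \<alpha>)"
        by (cases la)
      have A: "A k p = (\<lambda>x. \<Sum>\<beta>\<in>UNIV. if {\<alpha>, \<beta>} = p then if l = i \<or> l = j then 0 else m x l $ \<beta> else 0)"
        by (simp add: A_def Inr la fun_eq_iff)
      have "real_polynomial_function (A k p)"
        unfolding A m_def
      proof (rule real_polynomial_function_sum)
        fix \<beta> :: "('n, 'd) multi_index"
        show "real_polynomial_function (\<lambda>x :: (real \<times> (real ^ 'n)) ^ 's.
            if {\<alpha>, \<beta>} = p then if l = i \<or> l = j then 0
            else monomials (snd (x $ l)) $ \<beta> else 0)"
          by (cases "{\<alpha>, \<beta>} = p"; cases "l = i \<or> l = j")
            (simp_all add: real_polynomial_function_monomials real_polynomial_function.intros(2))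
      qed simp
      moreover have "A k p x = A k p y" if "\<forall>k. k \<noteq> i \<longrightarrow> k \<noteq> j \<longrightarrow> x $ k = y $ k" for x y
        using that unfolding A m_def by (intro sum.cong refl) auto
      ultimately show ?thesis
        by (rule RI)
    qed
  qed
  then obtain q where q: "\<And>p. q p \<in> R" "\<exists>p\<in>J. \<exists>x. q p x \<noteq> 0"
    "\<And>k x. k \<in> K \<Longrightarrow> (\<Sum>p\<in>J. A k p x * q p x) = 0"
    by blast
  \<comment> \<open>Indexing the unknowns by unordered pairs makes \<open>Q x\<close> symmetric by
    construction.\<close>
  define Q :: "(real \<times> (real ^ 'n)) ^ 's \<Rightarrow> real ^ ('n, 'd) multi_index ^ ('n, 'd) multi_index"
    where "Q = (\<lambda>x. \<chi> \<alpha> \<beta>. q {\<alpha>, \<beta>} x)"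
  have sym: "transpose (Q x) = Q x" for x
    by (simp add: Q_def transpose_def insert_commute)
  have orth: "(\<Sum>\<alpha>\<in>UNIV. \<Sum>\<beta>\<in>UNIV. Q x $ \<alpha> $ \<beta> * Y $ \<alpha> $ \<beta>) = 0" if "Y \<in> hankel" for x Y
  proof (rule hankel_orthogonal[OF that])
    fix \<gamma> :: "'n option \<Rightarrow> nat"
    assume "(\<Sum>i\<in>UNIV. \<gamma> i) = 2 * CARD('d)"
    then have "Inl \<gamma> \<in> K"
      by (simp add: K_def \<Gamma>_def)
    then have "0 = (\<Sum>p\<in>J. A (Inl \<gamma>) p x * q p x)"
      by (simp add: q(3))
    also have "\<dots> = (\<Sum>ab\<in>UNIV. (if (\<lambda>i. expo (fst ab) i + expo (snd ab) i) = \<gamma> then 1 else 0) * q {fst ab, snd ab} x)"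
      unfolding A_def sum.case by (rule sum_unordered_pairs) (simp_all add: pair_in_J)
    also have "\<dots> = (\<Sum>ab\<in>{ab. (\<lambda>i. expo (fst ab) i + expo (snd ab) i) = \<gamma>}. q {fst ab, snd ab} x)"
      by (rule sum.mono_neutral_cong_right) auto
    finally show "(\<Sum>ab\<in>{ab. (\<lambda>i. expo (fst ab) i + expo (snd ab) i) = \<gamma>}. Q x $ fst ab $ snd ab) = 0"
      by (simp add: Q_def)
  qed
  have kill: "Q x *v m x k = 0" if "k \<noteq> i" "k \<noteq> j" for x k
  proof -
    have "(Q x *v m x k) $ \<alpha> = 0" for \<alpha>
    proof -
      have "Inr (k, \<alpha>) \<in> K"
        using that by (auto simp: K_def)
      then have "0 = (\<Sum>p\<in>J. A (Inr (k, \<alpha>)) p x * q p x)"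
        by (simp add: q(3))
      also have "\<dots> = (\<Sum>\<beta>\<in>UNIV. m x k $ \<beta> * q {\<alpha>, \<beta>} x)"
        unfolding A_def sum.case prod.case using that
        by (simp only: simp_thms if_False) (rule sum_unordered_pairs, simp_all add: pair_in_J)
      finally show ?thesis
        by (simp add: matrix_vector_mult_def Q_def mult.commute)
    qed
    then show ?thesis
      by (simp add: vec_eq_iff)
  qed
  define F where "F = (\<lambda>x. m x i \<bullet> (Q x *v m x j))"
  have "real_polynomial_function F"
  proof -
    have "F = (\<lambda>x. \<Sum>\<alpha>\<in>UNIV. m x i $ \<alpha> * (\<Sum>\<beta>\<in>UNIV. q {\<alpha>, \<beta>} x * m x j $ \<beta>))"
      by (simp add: F_def inner_vec_def matrix_vector_mult_def Q_def)
    moreover have "real_polynomial_function (q p)" for p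
      using q(1) by (simp add: R_def)
    ultimately show ?thesis
      unfolding m_def
      by (auto intro!: real_polynomial_function_sum real_polynomial_function.intros(4) real_polynomial_function_monomials)
  qed
  moreover have "\<exists>x. F x \<noteq> 0"
  proof -
    obtain \<alpha> \<beta> x0 where "q {\<alpha>, \<beta>} x0 \<noteq> 0"
      using q(2) by (auto simp: J_def)
    then have "Q x0 $ \<alpha> \<noteq> 0"
      by (auto simp: Q_def vec_eq_iff)
    then obtain z where "Q x0 $ \<alpha> \<bullet> monomials z \<noteq> 0"
      using monomials_spanning by blast
    then have "(Q x0 *v monomials z) $ \<alpha> \<noteq> 0"
      by (simp add: matrix_vector_mult_def inner_vec_def)
    then have "Q x0 *v monomials z \<noteq> 0"
      by auto
    then obtain y where y: "(Q x0 *v monomials z) \<bullet> monomials y \<noteq> 0"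
      using monomials_spanning by blast
    \<comment> \<open>The points \<open>i\<close> and \<open>j\<close> are replaced by
      \<open>y\<close> and \<open>z\<close>; their weights \<open>0\<close> are arbitrary, since
      \<open>m\<close> reads only the points.\<close>
    define x where "x = (\<chi> k. if k = i then (0, y) else if k = j then (0, z) else x0 $ k)"
    have "q p x = q p x0" for p
    proof -
      have "\<forall>k. k \<noteq> i \<longrightarrow> k \<noteq> j \<longrightarrow> x $ k = x0 $ k"
        by (simp add: x_def)
      then show ?thesis
        by (rule RD[OF q(1)])
    qed
    then have "Q x = Q x0"
      by (simp add: Q_def)
    moreover have "m x i = monomials y" "m x j = monomials z"
      using \<open>i \<noteq> j\<close> by (simp_all add: m_def x_def)
    ultimately have "F x \<noteq> 0"
      using y by (simp add: F_def inner_commute)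
    then show ?thesis ..
  qed
  moreover have "\<exists>Q :: real ^ ('n, 'd) multi_index ^ ('n, 'd) multi_index. transpose Q = Q \<and>
      (\<forall>Y\<in>hankel. (\<Sum>\<alpha>\<in>UNIV. \<Sum>\<beta>\<in>UNIV. Q $ \<alpha> $ \<beta> * Y $ \<alpha> $ \<beta>) = 0) \<and>
      (\<forall>k. k \<noteq> i \<longrightarrow> k \<noteq> j \<longrightarrow> Q *v monomials (snd (x $ k)) = 0) \<and>
      monomials (snd (x $ i)) \<bullet> (Q *v monomials (snd (x $ j))) \<noteq> 0" if "F x \<noteq> 0" for x
    using that sym orth kill unfolding F_def m_def by (intro exI[of _ "Q x"]) auto
  ultimately show ?thesis
    by blast
qed

section \<open>Hyperplanes of symmetric matrices are Lebesgue null\<close>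

text \<open>Fubini in the coordinate \<open>p\<close>: with the other coordinates fixed, the
  equation has the single solution \<open>y0\<close>, and a point is null on the line.\<close>

lemma null_sets_PiM_hyperplane:
  fixes a :: "'i \<Rightarrow> real"
  assumes "finite I" "p \<in> I" "a p \<noteq> 0"
  shows "{x \<in> space (\<Pi>\<^sub>M i\<in>I. lborel). (\<Sum>i\<in>I. a i * x i) = 0} \<in> null_sets (\<Pi>\<^sub>M i\<in>I. (lborel :: real measure))"
    (is "?S \<in> _")
proof -
  interpret product_sigma_finite "\<lambda>_::'i. lborel :: real measure"
    by standard
  define J where "J = I - {p}"
  have I: "I = insert p J" "finite J" "p \<notin> J"
    using assms by (auto simp: J_def)
  have meas: "?S \<in> sets (\<Pi>\<^sub>M i\<in>I. lborel)"
    by measurable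
  have "emeasure (\<Pi>\<^sub>M i\<in>I. lborel) ?S = (\<integral>\<^sup>+ x. indicator ?S x \<partial>(\<Pi>\<^sub>M i\<in>I. lborel))"
    using meas by simp
  also have "\<dots> = (\<integral>\<^sup>+ x. (\<integral>\<^sup>+ y. indicator ?S (x(p := y)) \<partial>lborel) \<partial>(\<Pi>\<^sub>M i\<in>J. lborel))"
    using meas I unfolding I(1) by (intro product_nn_integral_insert) auto
  also have "\<dots> = (\<integral>\<^sup>+ x. 0 \<partial>(\<Pi>\<^sub>M i\<in>J. (lborel :: real measure)))"
  proof (rule nn_integral_cong)
    fix x :: "'i \<Rightarrow> real"
    assume x: "x \<in> space (\<Pi>\<^sub>M i\<in>J. lborel)"
    define y0 where "y0 = - (\<Sum>i\<in>J. a i * x i) / a p"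
    have "x(p := y) \<in> ?S \<longleftrightarrow> y = y0" for y
    proof -
      have "(\<Sum>i\<in>I. a i * (x(p := y)) i) = a p * y + (\<Sum>i\<in>J. a i * x i)"
        unfolding I(1) using I(2,3) by (simp add: sum.insert) (auto intro!: sum.cong)
      moreover have "x(p := y) \<in> space (\<Pi>\<^sub>M i\<in>I. lborel)"
        using x unfolding I(1) by (auto simp: space_PiM PiE_iff extensional_def)
      ultimately show ?thesis
        using assms(3) by (auto simp: y0_def field_simps)
    qed
    then have "(\<integral>\<^sup>+ y. indicator ?S (x(p := y)) \<partial>lborel) = (\<integral>\<^sup>+ y. indicator {y0} y \<partial>lborel)"
      by (intro nn_integral_cong) (simp add: indicator_def)
    then show "(\<integral>\<^sup>+ y. indicator ?S (x(p := y)) \<partial>lborel) = 0"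
      by simp
  qed
  finally show ?thesis
    using meas by (simp add: null_sets_def)
qed

text \<open>In the coordinates indexed by unordered pairs the trace pairing with \<open>G\<close> is
  the linear functional with coefficients \<open>a p\<close>, so the set pulls back to a
  hyperplane.\<close>

lemma null_sets_sym_lborel_hyperplane:
  fixes G :: "real ^ 'm ^ 'm::finite"
  assumes "transpose G = G" "G \<noteq> 0"
  shows "{B. trace (B ** G) = 0} \<in> null_sets sym_lborel"
proof -
  define I where "I = {p :: 'm set. \<exists>i j. p = {i, j}}"
  define a where "a = (\<lambda>p. \<Sum>ij\<in>UNIV. if {fst ij, snd ij} = p then G $ snd ij $ fst ij else 0)"
  have sym: "G $ i $ j = G $ j $ i" for i j
    using assms(1) by (metis transpose_def vec_lambda_beta)
  obtain i j where ij: "G $ i $ j \<noteq> 0"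
    using assms(2) by (auto simp: vec_eq_iff)
  \<comment> \<open>By symmetry all positions over the pair \<open>{i, j}\<close> carry the same
    entry of \<open>G\<close>, so their contributions cannot cancel.\<close>
  have "a {i, j} = (\<Sum>kl\<in>UNIV. if {fst kl, snd kl} = {i, j} then G $ i $ j else 0)"
    unfolding a_def by (intro sum.cong refl) (auto simp: doubleton_eq_iff sym)
  also have "\<dots> = real (card {kl. {fst kl, snd kl} = {i, j}}) * G $ i $ j"
    by (simp add: sum.If_cases)
  also have "\<dots> \<noteq> 0"
  proof -
    have "(i, j) \<in> {kl. {fst kl, snd kl} = {i, j}}"
      by simp
    then have "card {kl. {fst kl, snd kl} = {i, j}} \<noteq> 0"
      by (subst card_0_eq) auto
    with ij show ?thesis
      by simp
  qed
  finally have "a {i, j} \<noteq> 0" .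
  have trace: "trace (sym_matrix x ** G) = (\<Sum>p\<in>I. a p * x p)" for x
  proof -
    have "trace (sym_matrix x ** G) = (\<Sum>ij\<in>UNIV. G $ snd ij $ fst ij * x {fst ij, snd ij})"
      by (simp add: trace_def matrix_matrix_mult_def sym_matrix_def sum.cartesian_product split_beta mult.commute)
    also have "\<dots> = (\<Sum>p\<in>I. a p * x p)"
      unfolding a_def by (rule sum_unordered_pairs[symmetric]) (auto simp: I_def)
    finally show ?thesis .
  qed
  have "(\<lambda>B. trace (B ** G)) \<in> borel_measurable borel"
    by (intro borel_measurable_continuous_onI)
      (auto simp: trace_def matrix_matrix_mult_def intro!: continuous_intros)
  then have meas: "{B. trace (B ** G) = 0} \<in> sets borel"
    using measurable_sets[of "\<lambda>B. trace (B ** G)" borel borel "{0}"] by (simp add: vimage_def)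
  moreover have "sym_matrix -` {B. trace (B ** G) = 0} \<inter> space (\<Pi>\<^sub>M p\<in>I. (lborel :: real measure))
      \<in> null_sets (\<Pi>\<^sub>M p\<in>I. lborel)"
  proof -
    have "sym_matrix -` {B. trace (B ** G) = 0} \<inter> space (\<Pi>\<^sub>M p\<in>I. (lborel :: real measure))
        = {x \<in> space (\<Pi>\<^sub>M p\<in>I. lborel). (\<Sum>p\<in>I. a p * x p) = 0}"
      by (auto simp: trace)
    moreover have "\<dots> \<in> null_sets (\<Pi>\<^sub>M p\<in>I. lborel)"
      by (rule null_sets_PiM_hyperplane[of I "{i, j}"]) (use \<open>a {i, j} \<noteq> 0\<close> in \<open>auto simp: I_def\<close>)
    ultimately show ?thesis
      by simp
  qed
  ultimately show ?thesis
    unfolding sym_lborel_def I_def by (subst null_sets_distr_iff[OF measurable_sym_matrix]) simp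
qed

lemma AE_trace_mult_nonzero:
  fixes G :: "real ^ 'm ^ 'm::finite"
  assumes "B \<in> borel_measurable \<Omega>" "absolutely_continuous sym_lborel (distr \<Omega> borel B)"
    and "transpose G = G" "G \<noteq> 0"
  shows "AE \<omega> in \<Omega>. trace (B \<omega> ** G) \<noteq> 0"
proof -
  have "{B. trace (B ** G) = 0} \<in> null_sets (distr \<Omega> borel B)"
    using null_sets_sym_lborel_hyperplane[OF assms(3,4)] assms(2) by (auto simp: absolutely_continuous_def)
  then have "AE A in distr \<Omega> borel B. A \<notin> {B. trace (B ** G) = 0}"
    by (rule AE_not_in)
  from AE_distrD[OF assms(1) this] show ?thesis
    by simp
qed

section \<open>The face of a generic moment matrix\<close>

lemma subspace_hankel: "subspace (hankel :: (real ^ ('n, 'd) multi_index ^ ('n::finite, 'd::finite) multi_index) set)"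
  unfolding subspace_def
proof (intro conjI ballI allI)
  fix A B :: "real ^ ('n, 'd) multi_index ^ ('n, 'd) multi_index" and c :: real
  assume A: "A \<in> hankel"
  show "c *\<^sub>R A \<in> hankel"
    using A by (simp add: hankel_def transpose_def vec_eq_iff)
  assume B: "B \<in> hankel"
  show "A + B \<in> hankel"
    unfolding hankel_def mem_Collect_eq
  proof (intro conjI allI impI)
    show "transpose (A + B) = A + B"
      using A B by (simp add: hankel_def transpose_def vec_eq_iff)
    fix \<alpha> \<beta> \<alpha>' \<beta>' :: "('n, 'd) multi_index"
    assume "\<forall>i. expo \<alpha> i + expo \<beta> i = expo \<alpha>' i + expo \<beta>' i"
    then have "A $ \<alpha> $ \<beta> = A $ \<alpha>' $ \<beta>'" "B $ \<alpha> $ \<beta> = B $ \<alpha>' $ \<beta>'"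
      using A B unfolding hankel_def by blast+
    then show "(A + B) $ \<alpha> $ \<beta> = (A + B) $ \<alpha>' $ \<beta>'"
      by simp
  qed
qed (simp add: hankel_def transpose_def vec_eq_iff)

lemma outer_monomials_in_hankel: "outer (monomials z) \<in> hankel"
proof -
  have "monomials z $ \<alpha> * monomials z $ \<beta> = (\<Prod>j\<in>UNIV. z $ j ^ (expo \<alpha> (Some j) + expo \<beta> (Some j)))"
    for \<alpha> \<beta> :: "('a, 'b) multi_index"
    by (simp add: monomials_nth power_add prod.distrib)
  then show ?thesis
    by (simp add: hankel_def transpose_outer outer_nth)
qed

lemma inner_matrix_vec: "x \<bullet> (Q *v y) = (\<Sum>\<alpha>\<in>UNIV. \<Sum>\<beta>\<in>UNIV. Q $ \<alpha> $ \<beta> * (x $ \<alpha> * (y :: real ^ 'n) $ \<beta>))"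
  by (simp add: inner_vec_def matrix_vector_mult_def sum_distrib_left mult_ac)

text \<open>Up to scaling, \<open>Q i j *v v i\<close> is a vector dual to \<open>v j\<close>, so the linear independence of the
  \<open>v i\<close> need not be arranged separately.\<close>

lemma simplicial_section_hankel:
  fixes z :: "'s::finite \<Rightarrow> real ^ 'n::finite"
    and Q :: "'s \<Rightarrow> 's \<Rightarrow> real ^ ('n, 'd::finite) multi_index ^ ('n, 'd) multi_index"
  defines "v \<equiv> \<lambda>i. monomials (z i)"
  assumes sym: "\<And>i j. i \<noteq> j \<Longrightarrow> transpose (Q i j) = Q i j"
    and orth: "\<And>i j Y. i \<noteq> j \<Longrightarrow> Y \<in> hankel \<Longrightarrow> (\<Sum>\<alpha>\<in>UNIV. \<Sum>\<beta>\<in>UNIV. Q i j $ \<alpha> $ \<beta> * Y $ \<alpha> $ \<beta>) = 0"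
    and kill: "\<And>i j k. i \<noteq> j \<Longrightarrow> k \<noteq> i \<Longrightarrow> k \<noteq> j \<Longrightarrow> Q i j *v v k = 0"
    and nonzero: "\<And>i j. i \<noteq> j \<Longrightarrow> v i \<bullet> (Q i j *v v j) \<noteq> 0"
  shows "\<exists>e. simplicial_section hankel v e"
proof -
  have outer: "outer (v i) \<in> hankel" for i
    by (simp add: v_def outer_monomials_in_hankel)
  \<comment> \<open>The quadric \<open>Q i j\<close> passes through every \<open>v k\<close>,
    because \<open>outer (v k)\<close> is a Hankel matrix.\<close>
  have isotropic: "v k \<bullet> (Q i j *v v k) = 0" if "i \<noteq> j" for i j k
    unfolding inner_matrix_vec using orth[OF that outer[of k]] by (simp add: outer_nth)
  \<comment> \<open>Only the mixed values between \<open>v i\<close> and \<open>v j\<close> survive: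
    other indices lie in the kernel, and the remaining diagonal values vanish by
    \<open>isotropic\<close>.\<close>
  have b: "v k \<bullet> (Q i j *v v l) = (if k = i \<and> l = j \<or> k = j \<and> l = i then v i \<bullet> (Q i j *v v j) else 0)"
    if "i \<noteq> j" for i j k l
  proof -
    have comm: "v k \<bullet> (Q i j *v v l) = v l \<bullet> (Q i j *v v k)"
      by (rule symmetric_matrix_inner[OF sym[OF that]])
    show ?thesis
    proof (cases "k \<noteq> i \<and> k \<noteq> j")
      case True
      then show ?thesis
        using comm kill[OF that, of k] by auto
    next
      case k: False
      show ?thesis
      proof (cases "l \<noteq> i \<and> l \<noteq> j")
        case True
        then show ?thesis
          using kill[OF that, of l] by auto
      next
        case False
        with k have "k = i \<and> l = j \<or> k = j \<and> l = i \<or> k = l"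
          by blast
        then show ?thesis
          using that isotropic[OF that, of k] comm by auto
      qed
    qed
  qed
  have "\<exists>e. \<forall>k. e \<bullet> v k = (if j = k then 1 else 0)" for j
  proof (cases "\<exists>i. i \<noteq> j")
    case True
    then obtain i where "i \<noteq> j"
      by blast
    define q where "q = v i \<bullet> (Q i j *v v j)"
    have "q \<noteq> 0"
      using nonzero[OF \<open>i \<noteq> j\<close>] by (simp add: q_def)
    show ?thesis
    proof (intro exI[of _ "(1 / q) *\<^sub>R (Q i j *v v i)"] allI)
      fix k
      have "(Q i j *v v i) \<bullet> v k = v k \<bullet> (Q i j *v v i)"
        by (rule inner_commute)
      also have "\<dots> = (if j = k then q else 0)"
        unfolding q_def by (subst b[OF \<open>i \<noteq> j\<close>]) (use \<open>i \<noteq> j\<close> in auto)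
      finally show "((1 / q) *\<^sub>R (Q i j *v v i)) \<bullet> v k = (if j = k then 1 else 0)"
        using \<open>q \<noteq> 0\<close> by simp
    qed
  next
    \<comment> \<open>With a single point there is no pair and no quadric; \<open>v j\<close>,
      rescaled, is its own dual.\<close>
    case False
    have "v j \<noteq> 0"
      using monomials_const_index[of "z j", where 'b = 'd] by (auto simp: v_def)
    then show ?thesis
      using False by (intro exI[of _ "(1 / (v j \<bullet> v j)) *\<^sub>R v j"]) auto
  qed
  then obtain e where e: "\<And>j k. e j \<bullet> v k = (if j = k then 1 else 0)"
    by metis
  have "simplicial_section hankel v e"
  proof
    show "subspace (hankel :: (real ^ ('n, 'd) multi_index ^ ('n, 'd) multi_index) set)"
      by (rule subspace_hankel)
    show "outer (v i) \<in> hankel" for i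
      by (rule outer)
    show "e i \<bullet> v j = (if i = j then 1 else 0)" for i j
      by (rule e)
    fix Y and S :: "'s \<Rightarrow> 's \<Rightarrow> real" and i j :: 's
    assume Y: "Y \<in> hankel" and YS: "\<And>y. Y *v y = (\<Sum>l\<in>UNIV. \<Sum>k\<in>UNIV. (S k l * (v l \<bullet> y)) *\<^sub>R v k)"
      and S: "\<And>k l. S k l = S l k" and "i \<noteq> j"
    define q where "q = v i \<bullet> (Q i j *v v j)"
    have q: "v k \<bullet> (Q i j *v v l) = (if k = i \<and> l = j \<or> k = j \<and> l = i then q else 0)" for k l
      unfolding q_def by (rule b[OF \<open>i \<noteq> j\<close>])
    have Y_nth: "Y $ \<alpha> $ \<beta> = (\<Sum>l\<in>UNIV. \<Sum>k\<in>UNIV. S k l * (v k $ \<alpha> * v l $ \<beta>))" for \<alpha> \<beta>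
    proof -
      have "Y $ \<alpha> $ \<beta> = (Y *v axis \<beta> 1) $ \<alpha>"
        by (simp add: matrix_vector_mul_component inner_axis)
      also have "\<dots> = (\<Sum>l\<in>UNIV. \<Sum>k\<in>UNIV. S k l * (v k $ \<alpha> * v l $ \<beta>))"
        unfolding YS by (simp add: sum_component inner_axis mult_ac)
      finally show ?thesis .
    qed
    \<comment> \<open>In the pairing of \<open>Q i j\<close> with the expansion of \<open>Y\<close>,
      only the terms at \<open>(i, j)\<close> and \<open>(j, i)\<close> survive by \<open>q\<close>,
      and symmetry of \<open>S\<close> makes them equal.\<close>
    have "0 = (\<Sum>\<alpha>\<in>UNIV. \<Sum>\<beta>\<in>UNIV. Q i j $ \<alpha> $ \<beta> * Y $ \<alpha> $ \<beta>)"
      by (rule orth[OF \<open>i \<noteq> j\<close> Y, symmetric])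
    also have "\<dots> = (\<Sum>\<alpha>\<in>UNIV. \<Sum>\<beta>\<in>UNIV. \<Sum>l\<in>UNIV. \<Sum>k\<in>UNIV. S k l * (Q i j $ \<alpha> $ \<beta> * (v k $ \<alpha> * v l $ \<beta>)))"
      by (simp add: Y_nth sum_distrib_left mult_ac)
    also have "\<dots> = (\<Sum>\<alpha>\<in>UNIV. \<Sum>l\<in>UNIV. \<Sum>k\<in>UNIV. \<Sum>\<beta>\<in>UNIV. S k l * (Q i j $ \<alpha> $ \<beta> * (v k $ \<alpha> * v l $ \<beta>)))"
      by (intro sum.cong refl) (subst sum.swap, intro sum.cong refl, rule sum.swap)
    also have "\<dots> = (\<Sum>l\<in>UNIV. \<Sum>k\<in>UNIV. \<Sum>\<alpha>\<in>UNIV. \<Sum>\<beta>\<in>UNIV. S k l * (Q i j $ \<alpha> $ \<beta> * (v k $ \<alpha> * v l $ \<beta>)))"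
      by (subst sum.swap, intro sum.cong refl, rule sum.swap)
    also have "\<dots> = (\<Sum>l\<in>UNIV. \<Sum>k\<in>UNIV. S k l * (v k \<bullet> (Q i j *v v l)))"
      by (simp add: inner_matrix_vec sum_distrib_left)
    also have "\<dots> = (\<Sum>lk\<in>UNIV. S (snd lk) (fst lk) * (v (snd lk) \<bullet> (Q i j *v v (fst lk))))"
      by (simp add: sum.cartesian_product split_beta)
    also have "\<dots> = (\<Sum>lk\<in>{(i, j), (j, i)}. S (snd lk) (fst lk) * (v (snd lk) \<bullet> (Q i j *v v (fst lk))))"
      by (rule sum.mono_neutral_right) (auto simp: q)
    also have "\<dots> = 2 * (S i j * q)"
      using \<open>i \<noteq> j\<close> S[of j i] by (simp add: q)
    finally show "S i j = 0"
      using nonzero[OF \<open>i \<noteq> j\<close>] by (simp add: q_def)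
  qed
  then show ?thesis
    by blast
qed

text \<open>One polynomial collects all genericity conditions: the product of the weights and of the
  separating polynomials of all pairs of distinct indices. No factor vanishes identically, so
  neither does the product, and its nonvanishing set is Zariski-open and dense.\<close>

lemma generic_simplicial_section:
  assumes "real CARD('s::finite) \<le>
      (real ((CARD('n::finite) + CARD('d::finite)) choose CARD('d)) + 1) / 2
      - real ((CARD('n) + 2 * CARD('d)) choose (2 * CARD('d)))
        / real ((CARD('n) + CARD('d)) choose CARD('d))"
  shows "generically (\<lambda>x :: (real \<times> (real ^ 'n)) ^ 's. (\<forall>i. fst (x $ i) \<noteq> 0) \<and>
    (\<exists>e. simplicial_section hankel (\<lambda>i. monomials (snd (x $ i)) :: real ^ ('n, 'd) multi_index) e))"
proof -
  define N where "N = (CARD('n) + CARD('d)) choose CARD('d)"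
  define c where "c = (CARD('n) + 2 * CARD('d)) choose (2 * CARD('d))"
  define E where "E = card {p :: ('n, 'd) multi_index set. \<exists>\<alpha> \<beta>. p = {\<alpha>, \<beta>}}"
  \<comment> \<open>Multiplying the hypothesis by \<open>N\<close> gives
    \<open>s * N + c \<le> N * (N + 1) / 2\<close>, and the right side is \<open>E\<close>. Leaving
    out two points makes this strict; the truncated subtraction is why \<open>s\<close> has to be at
    least two.\<close>
  have bound: "c + (CARD('s) - 2) * CARD(('n, 'd) multi_index) < E" if "CARD('s) \<ge> 2"
  proof -
    have "N > 0"
      by (simp add: N_def)
    have "2 * E = N * (N + 1)"
      unfolding E_def card_unordered_pairs card_multi_index N_def ..
    then have "2 * real E = real N * (real N + 1)"
      by (metis of_nat_1 of_nat_add of_nat_mult of_nat_numeral)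
    moreover have "real CARD('s) * real N \<le> ((real N + 1) / 2 - real c / real N) * real N"
      using assms by (intro mult_right_mono) (simp_all add: N_def c_def)
    moreover have "((real N + 1) / 2 - real c / real N) * real N = real N * (real N + 1) / 2 - real c"
      using \<open>N > 0\<close> by (simp add: field_simps)
    ultimately have "real CARD('s) * real N + real c \<le> real E"
      by linarith
    then have "CARD('s) * N + c \<le> E"
      by (metis of_nat_add of_nat_le_iff of_nat_mult)
    moreover have "(CARD('s) - 2) * N < CARD('s) * N"
      using that \<open>N > 0\<close> by simp
    ultimately show ?thesis
      unfolding card_multi_index N_def[symmetric] by linarith
  qed
  define good where "good = (\<lambda>i j (x :: (real \<times> (real ^ 'n)) ^ 's) Q. transpose Q = Q \<and>
      (\<forall>Y\<in>hankel. (\<Sum>\<alpha>\<in>UNIV. \<Sum>\<beta>\<in>UNIV. Q $ \<alpha> $ \<beta> * Y $ \<alpha> $ \<beta>) = 0) \<and>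
      (\<forall>k. k \<noteq> i \<longrightarrow> k \<noteq> j \<longrightarrow> Q *v monomials (snd (x $ k)) = (0 :: real ^ ('n, 'd) multi_index)) \<and>
      monomials (snd (x $ i)) \<bullet> (Q *v monomials (snd (x $ j))) \<noteq> 0)"
  have "\<exists>F :: (real \<times> (real ^ 'n)) ^ 's \<Rightarrow> real. real_polynomial_function F \<and> (\<exists>x. F x \<noteq> 0) \<and>
    (\<forall>x. F x \<noteq> 0 \<longrightarrow> (\<exists>Q. good i j x Q))" if "i \<noteq> j" for i j
  proof -
    have "card {i, j} \<le> CARD('s)"
      by (rule card_mono) auto
    then have "CARD('s) \<ge> 2"
      using that by simp
    then show ?thesis
      using generic_separating_quadric[OF that] bound unfolding good_def c_def E_def by blast
  qed
  then have "\<exists>F. \<forall>i j. i \<noteq> j \<longrightarrow> real_polynomial_function (F i j) \<and> (\<exists>x. F i j x \<noteq> 0) \<and>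
    (\<forall>x. F i j x \<noteq> 0 \<longrightarrow> (\<exists>Q. good i j x Q))"
    by metis
  then obtain F where F: "\<And>i j. i \<noteq> j \<Longrightarrow> real_polynomial_function (F i j)"
    "\<And>i j. i \<noteq> j \<Longrightarrow> \<exists>x. F i j x \<noteq> 0"
    "\<And>i j x. i \<noteq> j \<Longrightarrow> F i j x \<noteq> 0 \<Longrightarrow> \<exists>Q. good i j x Q"
    by metis
  define p1 where "p1 = (\<lambda>x :: (real \<times> (real ^ 'n)) ^ 's. \<Prod>i\<in>UNIV. fst (x $ i))"
  define p2 where "p2 = (\<lambda>x. \<Prod>ij\<in>{ij. fst ij \<noteq> snd ij}. F (fst ij) (snd ij) x)"
  have "real_polynomial_function (\<lambda>x :: (real \<times> (real ^ 'n)) ^ 's. fst (x $ i))" for i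
    by (intro real_polynomial_function.intros(1) bounded_linear_compose[OF bounded_linear_fst]
        bounded_linear_vec_nth)
  then have poly: "real_polynomial_function p1" "real_polynomial_function p2"
    unfolding p1_def p2_def using F(1) by (auto intro!: real_polynomial_function_prod)
  have "p1 (\<chi> i. (1, 0)) \<noteq> 0"
    by (simp add: p1_def)
  moreover have "\<exists>x. p2 x \<noteq> 0"
    unfolding p2_def using F(1,2) by (intro real_polynomial_function_prod_nonzero) auto
  ultimately obtain x0 where x0: "p1 x0 * p2 x0 \<noteq> 0"
    using real_polynomial_function_mult_nonzero poly by blast
  have poly12: "real_polynomial_function (\<lambda>x. p1 x * p2 x)"
    by (intro real_polynomial_function.intros(4) poly)
  show ?thesis
    unfolding generically_def
  proof (intro exI[of _ "{x. p1 x * p2 x \<noteq> 0}"] conjI ballI)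
    show "zariski_closed (- {x. p1 x * p2 x \<noteq> 0})"
      unfolding zariski_closed_def using poly12 by (intro exI[of _ "{\<lambda>x. p1 x * p2 x}"]) auto
    show "closure {x. p1 x * p2 x \<noteq> 0} = UNIV"
      by (rule dense_real_polynomial_function_nonzero[OF poly12 x0])
    fix x
    assume "x \<in> {x. p1 x * p2 x \<noteq> 0}"
    then have "p1 x \<noteq> 0" "p2 x \<noteq> 0"
      by auto
    then show "\<forall>i. fst (x $ i) \<noteq> 0"
      by (simp add: p1_def)
    have "F i j x \<noteq> 0" if "i \<noteq> j" for i j
      using \<open>p2 x \<noteq> 0\<close> that by (auto simp: p2_def)
    then have "\<forall>i j. \<exists>Q. i \<noteq> j \<longrightarrow> good i j x Q"
      using F(3) by blast
    then obtain Q where Q: "\<And>i j. i \<noteq> j \<Longrightarrow> good i j x (Q i j)"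
      by metis
    show "\<exists>e. simplicial_section hankel (\<lambda>i. monomials (snd (x $ i)) :: real ^ ('n, 'd) multi_index) e"
      by (rule simplicial_section_hankel[of Q]) (use Q in \<open>auto simp: good_def\<close>)
  qed
qed

section \<open>Recovery of the atoms and weights\<close>

lemma trace_mult_diff: "trace (B ** (X - Y)) = trace (B ** X) - trace (B ** (Y :: real ^ 'n ^ 'n))"
  by (simp add: trace_def matrix_matrix_mult_def right_diff_distrib sum_subtractf)

context simplicial_section
begin

text \<open>Two vertices get equal values only on the hyperplane orthogonal to their difference, a
  nonzero symmetric matrix. The vertices are fixed before any draw, so countably many null sets
  suffice, one for each iteration and pair.\<close>

lemma AE_inj_trace_vertex:
  assumes "\<And>k. k \<ge> (1::nat) \<Longrightarrow> B k \<in> borel_measurable \<Omega>"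
    "\<And>k. k \<ge> 1 \<Longrightarrow> absolutely_continuous sym_lborel (distr \<Omega> borel (B k))"
  shows "AE \<omega> in \<Omega>. \<forall>k\<ge>1. inj (\<lambda>i. trace (B k \<omega> ** vertex i))"
proof -
  have "AE \<omega> in \<Omega>. k \<ge> 1 \<longrightarrow> (\<forall>ij\<in>{ij. fst ij \<noteq> snd ij}. trace (B k \<omega> ** (vertex (fst ij) - vertex (snd ij))) \<noteq> 0)" for k
  proof (cases "k \<ge> 1")
    case True
    have "AE \<omega> in \<Omega>. \<forall>ij\<in>{ij. fst ij \<noteq> snd ij}. trace (B k \<omega> ** (vertex (fst ij) - vertex (snd ij))) \<noteq> 0"
    proof (rule AE_finite_allI)
      fix ij :: "'s \<times> 's"
      assume "ij \<in> {ij. fst ij \<noteq> snd ij}"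
      then have "vertex (fst ij) - vertex (snd ij) \<noteq> 0"
        by (simp add: vertex_inject)
      moreover have "transpose (vertex (fst ij) - vertex (snd ij)) = vertex (fst ij) - vertex (snd ij)"
        by (simp add: vec_eq_iff transpose_def vertex_def outer_nth mult_ac)
      ultimately show "AE \<omega> in \<Omega>. trace (B k \<omega> ** (vertex (fst ij) - vertex (snd ij))) \<noteq> 0"
        by (intro AE_trace_mult_nonzero assms True)
    qed simp
    then show ?thesis
      by simp
  qed simp
  then have "AE \<omega> in \<Omega>. \<forall>k. k \<ge> 1 \<longrightarrow> (\<forall>ij\<in>{ij. fst ij \<noteq> snd ij}. trace (B k \<omega> ** (vertex (fst ij) - vertex (snd ij))) \<noteq> 0)"
    by (simp add: AE_all_countable)
  then show ?thesis
  proof (rule AE_mp, intro AE_I2 impI allI injI)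
    fix \<omega> k i j
    assume "\<forall>k. k \<ge> 1 \<longrightarrow> (\<forall>ij\<in>{ij. fst ij \<noteq> snd ij}. trace (B k \<omega> ** (vertex (fst ij) - vertex (snd ij))) \<noteq> 0)"
      and "1 \<le> k" and eq: "trace (B k \<omega> ** vertex i) = trace (B k \<omega> ** vertex j)"
    then have "\<forall>ij\<in>{ij. fst ij \<noteq> snd ij}. trace (B k \<omega> ** (vertex (fst ij) - vertex (snd ij))) \<noteq> 0"
      by blast
    from bspec[OF this, of "(i, j)"] have "i \<noteq> j \<longrightarrow> trace (B k \<omega> ** (vertex i - vertex j)) \<noteq> 0"
      by simp
    moreover have "trace (B k \<omega> ** (vertex i - vertex j)) = 0"
      using eq by (simp add: trace_mult_diff)
    ultimately show "i = j"
      by blast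
  qed
qed

text \<open>The reordering is unique because distinct indices have distinct vertices, so
  \<open>M k\<close> alone determines \<open>\<sigma> k\<close>.\<close>

lemma reordering_erd_output:
  assumes "\<And>i. w i \<noteq> 0" "\<forall>k\<ge>1. inj (\<lambda>i. trace (B k ** vertex i))"
    and "erd_output (L \<inter> psd_cone) (comb (\<lambda>i. (w i)\<^sup>2)) B r t M"
  shows "r = CARD('s)"
    and "\<exists>\<sigma>. reordering w v t M \<sigma> \<and> (\<forall>\<sigma>'. reordering w v t M \<sigma>' \<longrightarrow> (\<forall>k\<in>{1..CARD('s)}. \<sigma>' k = \<sigma> k))"
proof -
  have pos: "\<forall>i. 0 < (w i)\<^sup>2"
    using assms(1) by simp
  note out = erd_output_comb[OF pos assms(2,3)]
  show "r = CARD('s)"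
    by (rule out)
  obtain \<sigma> where \<sigma>: "bij_betw \<sigma> {1..CARD('s)} UNIV"
    "\<forall>k\<in>{1..CARD('s)}. t k = (w (\<sigma> k))\<^sup>2 * (norm (v (\<sigma> k)))\<^sup>2 \<and> M k = vertex (\<sigma> k)"
    using out(2) by blast
  have "reordering w v t M \<sigma>"
    unfolding reordering_def vertex_def[symmetric] using \<sigma> by blast
  moreover have "\<sigma>' k = \<sigma> k" if "reordering w v t M \<sigma>'" "k \<in> {1..CARD('s)}" for \<sigma>' k
  proof -
    have "M k = vertex (\<sigma>' k)"
      using that unfolding reordering_def vertex_def[symmetric] by blast
    moreover have "M k = vertex (\<sigma> k)"
      using \<sigma>(2) that(2) by blast
    ultimately show ?thesis
      by (metis vertex_inject)
  qed
  ultimately show "\<exists>\<sigma>. reordering w v t M \<sigma> \<and> (\<forall>\<sigma>'. reordering w v t M \<sigma>' \<longrightarrow> (\<forall>k\<in>{1..CARD('s)}. \<sigma>' k = \<sigma> k))"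
    by blast
qed

end

text \<open>Since the constant entry of \<open>m\<close> is one, the factor \<open>c\<close> in
  \<open>h = c *\<^sub>R m\<close>, sign included, is the constant entry of \<open>h\<close>. Unit
  length gives \<open>(norm m)\<^sup>2 * c\<^sup>2 = 1\<close>, which recovers the weight;
  \<open>a\<close> stands for the squared weight.\<close>

lemma recover_from_eigenvector:
  fixes z :: "real ^ 'n::finite"
  defines "m \<equiv> monomials z :: real ^ ('n, 'd::finite) multi_index"
  defines "A \<equiv> (1 / (norm m)\<^sup>2) *\<^sub>R outer m"
  shows "\<exists>!l. l \<noteq> 0 \<and> eigenvalue A l"
    and "\<And>l h. \<lbrakk>l \<noteq> 0; eigenvector A l h; norm h = 1\<rbrakk> \<Longrightarrow> h $ const_index \<noteq> 0 \<and>
      m = (1 / h $ const_index) *\<^sub>R h \<and> (\<forall>j. z $ j = ((1 / h $ const_index) *\<^sub>R h) $ linear_index j) \<and>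
      a = a * (norm m)\<^sup>2 * (h $ const_index)\<^sup>2"
proof -
  have m: "m $ const_index = 1"
    by (simp add: m_def monomials_const_index)
  then have "m \<noteq> 0"
    by auto
  then show "\<exists>!l. l \<noteq> 0 \<and> eigenvalue A l"
    using eigenvalue_rank_one[of m] eigenvector_rank_one(1)[of m]
    unfolding A_def eigenvalue_def by (metis zero_neq_one)
  fix l h
  assume h: "l \<noteq> 0" "eigenvector A l h" "norm h = 1"
  obtain c where c: "c \<noteq> 0" "h = c *\<^sub>R m"
    using eigenvector_rank_one(2)[OF \<open>m \<noteq> 0\<close> h(1)] h(2) unfolding A_def by blast
  have hc: "h $ const_index = c"
    by (simp add: c m)
  have mh: "m = (1 / h $ const_index) *\<^sub>R h"
    unfolding hc using c by simp
  moreover have "z $ j = ((1 / h $ const_index) *\<^sub>R h) $ linear_index j" for j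
    unfolding mh[symmetric] by (simp add: m_def monomials_linear_index)
  moreover have "(norm m)\<^sup>2 * c\<^sup>2 = 1"
    using h(3) unfolding c(2) by (metis mult.commute norm_scaleR one_power2 power2_abs power_mult_distrib)
  ultimately show "h $ const_index \<noteq> 0 \<and>
      m = (1 / h $ const_index) *\<^sub>R h \<and> (\<forall>j. z $ j = ((1 / h $ const_index) *\<^sub>R h) $ linear_index j) \<and>
      a = a * (norm m)\<^sup>2 * (h $ const_index)\<^sup>2"
    using c(1) hc by (simp add: mult.assoc)
qed

lemma generically_mono:
  assumes "generically P" "\<And>x. P x \<Longrightarrow> P' x"
  shows "generically P'"
  using assms unfolding generically_def by blast

text \<open>Outside the null event that some draw fails to separate the vertices, the argument is
  deterministic and applies to each outcome by itself.\<close>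

lemma AE_erd_recovers_atoms:
  fixes z :: "'s::finite \<Rightarrow> real ^ 'n::finite" and w :: "'s \<Rightarrow> real"
    and B :: "nat \<Rightarrow> 'w \<Rightarrow> real ^ ('n, 'd::finite) multi_index ^ ('n, 'd) multi_index"
  defines "m \<equiv> \<lambda>i. monomials (z i)"
  assumes simplicial: "simplicial_section hankel m e" and w: "\<And>i. w i \<noteq> 0"
    and B: "\<And>k. k \<ge> 1 \<Longrightarrow> B k \<in> borel_measurable \<Omega>"
      "\<And>k. k \<ge> 1 \<Longrightarrow> absolutely_continuous sym_lborel (distr \<Omega> borel (B k))"
  shows "AE \<omega> in \<Omega>.
        erd_terminates pseudo_moment_cone (\<Sum>i\<in>UNIV. (w i)\<^sup>2 *\<^sub>R outer (m i)) (\<lambda>k. B k \<omega>) \<and>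
        (\<forall>r t M. erd_output pseudo_moment_cone (\<Sum>i\<in>UNIV. (w i)\<^sup>2 *\<^sub>R outer (m i)) (\<lambda>k. B k \<omega>) r t M \<longrightarrow>
          r = CARD('s) \<and>
          (\<exists>\<sigma>. reordering w m t M \<sigma> \<and>
            (\<forall>\<sigma>'. reordering w m t M \<sigma>' \<longrightarrow> (\<forall>k\<in>{1..CARD('s)}. \<sigma>' k = \<sigma> k)) \<and>
            (\<forall>k\<in>{1..CARD('s)}.
              (\<exists>!l. l \<noteq> 0 \<and> eigenvalue (M k) l) \<and>
              (\<forall>l h. l \<noteq> 0 \<and> eigenvector (M k) l h \<and> norm h = 1 \<longrightarrow>
                h $ const_index \<noteq> 0 \<and>
                m (\<sigma> k) = (1 / h $ const_index) *\<^sub>R h \<and>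
                (\<forall>j. z (\<sigma> k) $ j = ((1 / h $ const_index) *\<^sub>R h) $ linear_index j) \<and>
                (w (\<sigma> k))\<^sup>2 = t k * (h $ const_index)\<^sup>2))))"
proof -
  interpret simplicial_section hankel m e
    by (rule simplicial)
  have X: "(\<Sum>i\<in>UNIV. (w i)\<^sup>2 *\<^sub>R outer (m i)) = comb (\<lambda>i. (w i)\<^sup>2)"
    by (simp add: comb_def)
  have "AE \<omega> in \<Omega>. \<forall>k\<ge>1. inj (\<lambda>i. trace (B k \<omega> ** vertex i))"
    using B by (rule AE_inj_trace_vertex)
  then show ?thesis
    unfolding pseudo_moment_cone_def X
  proof (rule AE_mp, intro AE_I2 impI conjI allI)
    fix \<omega>
    assume inj: "\<forall>k\<ge>1. inj (\<lambda>i. trace (B k \<omega> ** vertex i))"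
    show "erd_terminates (hankel \<inter> psd_cone) (comb (\<lambda>i. (w i)\<^sup>2)) (\<lambda>k. B k \<omega>)"
      using w by (intro erd_terminates_comb inj) simp
    fix r t M
    assume out: "erd_output (hankel \<inter> psd_cone) (comb (\<lambda>i. (w i)\<^sup>2)) (\<lambda>k. B k \<omega>) r t M"
    show "r = CARD('s)"
      by (rule reordering_erd_output(1)[OF w inj out])
    obtain \<sigma> where \<sigma>: "reordering w m t M \<sigma>"
      "\<forall>\<sigma>'. reordering w m t M \<sigma>' \<longrightarrow> (\<forall>k\<in>{1..CARD('s)}. \<sigma>' k = \<sigma> k)"
      using reordering_erd_output(2)[OF w inj out] by blast
    show "\<exists>\<sigma>. reordering w m t M \<sigma> \<and>
            (\<forall>\<sigma>'. reordering w m t M \<sigma>' \<longrightarrow> (\<forall>k\<in>{1..CARD('s)}. \<sigma>' k = \<sigma> k)) \<and>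
            (\<forall>k\<in>{1..CARD('s)}.
              (\<exists>!l. l \<noteq> 0 \<and> eigenvalue (M k) l) \<and>
              (\<forall>l h. l \<noteq> 0 \<and> eigenvector (M k) l h \<and> norm h = 1 \<longrightarrow>
                h $ const_index \<noteq> 0 \<and>
                m (\<sigma> k) = (1 / h $ const_index) *\<^sub>R h \<and>
                (\<forall>j. z (\<sigma> k) $ j = ((1 / h $ const_index) *\<^sub>R h) $ linear_index j) \<and>
                (w (\<sigma> k))\<^sup>2 = t k * (h $ const_index)\<^sup>2))"
    proof (intro exI[of _ \<sigma>] conjI \<sigma> ballI)
      fix k
      assume "k \<in> {1..CARD('s)}"
      then have tM: "t k = (w (\<sigma> k))\<^sup>2 * (norm (m (\<sigma> k)))\<^sup>2" "M k = (1 / (norm (m (\<sigma> k)))\<^sup>2) *\<^sub>R outer (m (\<sigma> k))"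
        using \<sigma>(1) by (auto simp: reordering_def)
      show "\<exists>!l. l \<noteq> 0 \<and> eigenvalue (M k) l"
        unfolding tM m_def by (rule recover_from_eigenvector)
      show "\<forall>l h. l \<noteq> 0 \<and> eigenvector (M k) l h \<and> norm h = 1 \<longrightarrow>
                h $ const_index \<noteq> 0 \<and>
                m (\<sigma> k) = (1 / h $ const_index) *\<^sub>R h \<and>
                (\<forall>j. z (\<sigma> k) $ j = ((1 / h $ const_index) *\<^sub>R h) $ linear_index j) \<and>
                (w (\<sigma> k))\<^sup>2 = t k * (h $ const_index)\<^sup>2"
        unfolding tM m_def by (intro allI impI recover_from_eigenvector(2)) auto
    qed
  qed
qed

theorem corollary1:
  assumes "CARD('d::finite) \<ge> 2"
    and "real CARD('s::finite) \<le>
      (real ((CARD('n::finite) + CARD('d)) choose CARD('d)) + 1) / 2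
      - real ((CARD('n) + 2 * CARD('d)) choose (2 * CARD('d)))
        / real ((CARD('n) + CARD('d)) choose CARD('d))"
  shows "generically (\<lambda>wz :: (real \<times> (real ^ 'n)) ^ 's.
    let w = (\<lambda>i. fst (wz $ i));
        z = (\<lambda>i. snd (wz $ i));
        m = (\<lambda>i. monomials (z i) :: real ^ ('n, 'd) multi_index);
        X = (\<Sum>i\<in>UNIV. (w i)\<^sup>2 *\<^sub>R outer (m i));
        C = pseudo_moment_cone
    in \<forall>(\<Omega> :: 'w measure) B.
      prob_space \<Omega> \<longrightarrow>
      prob_space.indep_vars \<Omega> (\<lambda>_. borel) B {1::nat..} \<longrightarrow>
      (\<forall>k\<ge>1. absolutely_continuous sym_lborel (distr \<Omega> borel (B k))) \<longrightarrow>
      (AE \<omega> in \<Omega>.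
        erd_terminates C X (\<lambda>k. B k \<omega>) \<and>
        (\<forall>r t M. erd_output C X (\<lambda>k. B k \<omega>) r t M \<longrightarrow>
          r = CARD('s) \<and>
          (\<exists>\<sigma>. reordering w m t M \<sigma> \<and>
            (\<forall>\<sigma>'. reordering w m t M \<sigma>' \<longrightarrow> (\<forall>k\<in>{1..CARD('s)}. \<sigma>' k = \<sigma> k)) \<and>
            (\<forall>k\<in>{1..CARD('s)}.
              (\<exists>!l. l \<noteq> 0 \<and> eigenvalue (M k) l) \<and>
              (\<forall>l h. l \<noteq> 0 \<and> eigenvector (M k) l h \<and> norm h = 1 \<longrightarrow>
                h $ const_index \<noteq> 0 \<and>
                m (\<sigma> k) = (1 / h $ const_index) *\<^sub>R h \<and>
                (\<forall>j. z (\<sigma> k) $ j = ((1 / h $ const_index) *\<^sub>R h) $ linear_index j) \<and>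
                (w (\<sigma> k))\<^sup>2 = t k * (h $ const_index)\<^sup>2))))))"
  (is "generically ?P")
proof (rule generically_mono[OF generic_simplicial_section[OF assms(2)]])
  fix wz :: "(real \<times> (real ^ 'n)) ^ 's"
  assume gen: "(\<forall>i. fst (wz $ i) \<noteq> 0) \<and>
      (\<exists>e. simplicial_section hankel (\<lambda>i. monomials (snd (wz $ i)) :: real ^ ('n, 'd) multi_index) e)"
  obtain e where e: "simplicial_section hankel (\<lambda>i. monomials (snd (wz $ i)) :: real ^ ('n, 'd) multi_index) e"
    using gen by blast
  have w: "fst (wz $ i) \<noteq> 0" for i
    using gen by blast
  show "?P wz"
    unfolding Let_def
    \<comment> \<open>The measurability of each draw is part of \<open>indep_vars\<close>.\<close>
    by (intro allI impI AE_erd_recovers_atoms[OF e w]) (simp_all add: prob_space.indep_vars_def)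
qed

end
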